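(* Let $T>0$, let $\alpha,\beta,\gamma\in(0,1)$ with $\alpha+2\beta>1$ and $\alpha+\beta+\gamma>1$, and let $\eta\le\gamma+\beta$. Let $\mathbf{X}=(X,\hat X,\mathbb{X})\in\mathscr{C}([0,T])$ be an inhomogeneous rough path and $(Y,Y')\in\mathscr{D}_{\hat X}^{\gamma+\beta,\eta}((0,T])$. Then the function $$\mathbf{Y}_t:=Y_t\,\mathbf 1+Y'_t\,\hat{\mathsf X}$$ is an element of $\mathcal{D}^{\gamma+\beta,\eta}((0,T])$. On the other hand, for every non-integer $\eta\le\gamma+\beta$ and any function in $\mathcal{D}^{\gamma+\beta,\eta}((0,T])$ with values in $\mathcal{T}_0\oplus\mathcal{T}_\beta$, its two components are an element of $\mathscr{D}_{\hat X}^{\gamma+\beta,\eta}((0,T])$. Moreover, there exists a constant $C>0$ depending on $T,\alpha,\beta,\gamma$ such that $$\frac1C\|\mathbf{Y}\|_{\mathcal{D}^{\gamma+\beta,\eta}}\le|Y_T|+|Y'_T|+\|Y,Y'\|_{\gamma+\beta,\eta}\le C\|\mathbf{Y}\|_{\mathcal{D}^{\gamma+\beta,\eta}} .$$ By replacing $\beta$ with $\alpha$ and $\hat{\mathsf X}$ with $\mathsf X$, one can equivalently describe $\mathscr{D}_X^{\gamma+\alpha,\eta}((0,T])$ with $\mathcal{D}^{\gamma+\alpha,\eta}((0,T])$.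
   Context: Inhomogeneous rough path: $\mathbf{X}=(X,\hat X,\mathbb{X})\in\mathscr{C}([0,T])$ means $X\in\mathcal{C}^\alpha([0,T])$, $\hat X\in\mathcal{C}^\beta([0,T])$, $|\mathbb{X}_{s,t}|\lesssim|t-s|^{\alpha+\beta}$ on $[0,T]^2$, and the Chen relation $\mathbb{X}_{s,t}=\mathbb{X}_{s,u}+\mathbb{X}_{u,t}+(\hat X_u-\hat X_s)(X_t-X_u)$ holds. Singular controlled rough paths: for $\eta\le\gamma+\beta$, $(Y,Y')\in\mathscr{D}_{\hat X}^{\gamma+\beta,\eta}((0,T])$ means that, with $R^Y_{s,t}:=Y_t-Y_s-Y'_s(\hat X_t-\hat X_s)$, $$\|Y,Y'\|_{\gamma+\beta,\eta}:=\sup_{0<s<t\le T}\frac{|Y'_t-Y'_s|}{s^{\eta-(\gamma+\beta)}|t-s|^\gamma}+\sup_{0<s<t\le T}\frac{|R^Y_{s,t}|}{s^{\eta-(\gamma+\beta)}|t-s|^{\gamma+\beta}}<\infty .$$ $\mathscr{D}_X^{\gamma+\alpha,\eta}((0,T])$ and its norm are defined identically with $\hat X$ replaced by $X$ and $\beta$ by $\alpha$. Regularity structure: $\mathcal{T}=\bigoplus_{l\in A}\mathcal{T}_l$, $A=\{\alpha-1,\beta-1,\alpha+\beta-1,0,\alpha,\beta,\alpha+\beta\}$, where the one-dimensional spaces $\mathcal{T}_l$ are spanned respectively by the symbols $\Xi,\hat\Xi,\hat{\mathsf X}\Xi,\mathbf 1,\mathsf X,\hat{\mathsf X},\mathsf{XX}$.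 For $s,t\in[0,T]$ let $h_1=X_t-X_s$, $h_2=\hat X_t-\hat X_s$, $h_3=\mathbb{X}_{s,t}$ and let $\Gamma_{t,s}:\mathcal{T}\to\mathcal{T}$ be the linear map fixing $\Xi,\hat\Xi,\mathbf 1$ and with $\Gamma_{t,s}(\hat{\mathsf X}\Xi)=\hat{\mathsf X}\Xi+h_2\Xi$, $\Gamma_{t,s}\mathsf X=\mathsf X+h_1\mathbf 1$, $\Gamma_{t,s}\hat{\mathsf X}=\hat{\mathsf X}+h_2\mathbf 1$, $\Gamma_{t,s}\mathsf{XX}=\mathsf{XX}+h_2\mathsf X+h_3\mathbf 1$. Singular modelled distributions: for $\delta>0$, $\eta\in\mathbb{R}$, a function $\mathbf{Y}:(0,T]\to\bigoplus_{l<\delta}\mathcal{T}_l$ belongs to $\mathcal{D}^{\delta,\eta}((0,T])$ if $$\|\mathbf{Y}\|_{\mathcal{D}^{\delta,\eta}}:=\sup_{l<\delta}\sup_{0<s\le T}\frac{|\mathbf{Y}_s|_l}{(s\wedge1)^{(\eta-l)\wedge0}}+\sup_{l<\delta}\sup_{\substack{0<s<t\le T\\|t-s|\le s}}\frac{|\mathbf{Y}_t-\Gamma_{t,s}\mathbf{Y}_s|_l}{(s\wedge1)^{\eta-\delta}|t-s|^{\delta-l}}<\infty,$$ where $|\cdot|_l$ is the absolute value of the $\mathcal{T}_l$-component and $a\wedge b=\min(a,b)$.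
   Formalization: The first inclusion and the left inequality exclude η=0 and η=β (resp. η=α), where they fail (e.g. Y=0, Y'=ln at η=β); C may depend also on η and on a bound for the Hölder constant of the driving path, since a C depending only on T,α,β,γ does not exist. *)

theory Defs
  imports "HOL-Analysis.Analysis"
begin

definition holder_bound :: "real \<Rightarrow> real \<Rightarrow> real \<Rightarrow> (real \<Rightarrow> real) \<Rightarrow> bool" where
  "holder_bound T \<alpha> K Z \<longleftrightarrow>
     (\<forall>s\<in>{0..T}. \<forall>t\<in>{0..T}. \<bar>Z t - Z s\<bar> \<le> K * \<bar>t - s\<bar> powr \<alpha>)"

definition holder_space :: "real \<Rightarrow> real \<Rightarrow> (real \<Rightarrow> real) set" where
  "holder_space T \<alpha> = {Z. \<exists>K. holder_bound T \<alpha> K Z}"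

(* In a triple (X, Xh, XX) the second path is X-hat and XX s t is the second-order process.
   Paths are total functions; only their values on [0,T] are ever used. *)
definition rough_path_space ::
    "real \<Rightarrow> real \<Rightarrow> real \<Rightarrow> ((real \<Rightarrow> real) \<times> (real \<Rightarrow> real) \<times> (real \<Rightarrow> real \<Rightarrow> real)) set" where
  "rough_path_space T \<alpha> \<beta> = {(X, Xh, XX).
     X \<in> holder_space T \<alpha> \<and> Xh \<in> holder_space T \<beta> \<and>
     (\<exists>K. \<forall>s\<in>{0..T}. \<forall>t\<in>{0..T}. \<bar>XX s t\<bar> \<le> K * \<bar>t - s\<bar> powr (\<alpha> + \<beta>)) \<and>
     (\<forall>s\<in>{0..T}. \<forall>u\<in>{0..T}. \<forall>t\<in>{0..T}.
        XX s t = XX s u + XX u t + (Xh u - Xh s) * (X t - X u))}"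

(* Z is the driving path and \<kappa> its Hoelder exponent: (Z, \<kappa>) is (X-hat, \<beta>) or (X, \<alpha>).
   The suprema are taken in ennreal, so that "finite" means "< \<infinity>". *)
definition controlled_norm ::
    "real \<Rightarrow> real \<Rightarrow> real \<Rightarrow> real \<Rightarrow> (real \<Rightarrow> real) \<Rightarrow> (real \<Rightarrow> real) \<times> (real \<Rightarrow> real) \<Rightarrow> ennreal" where
  "controlled_norm T \<kappa> \<gamma> \<eta> Z = (\<lambda>(Y, Y').
     (SUP (s, t) \<in> {(s, t). 0 < s \<and> s < t \<and> t \<le> T}.
        ennreal (\<bar>Y' t - Y' s\<bar> / (s powr (\<eta> - (\<gamma> + \<kappa>)) * \<bar>t - s\<bar> powr \<gamma>)))
   + (SUP (s, t) \<in> {(s, t). 0 < s \<and> s < t \<and> t \<le> T}.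
        ennreal (\<bar>Y t - Y s - Y' s * (Z t - Z s)\<bar>
                 / (s powr (\<eta> - (\<gamma> + \<kappa>)) * \<bar>t - s\<bar> powr (\<gamma> + \<kappa>)))))"

definition controlled_space ::
    "real \<Rightarrow> real \<Rightarrow> real \<Rightarrow> real \<Rightarrow> (real \<Rightarrow> real) \<Rightarrow> ((real \<Rightarrow> real) \<times> (real \<Rightarrow> real)) set" where
  "controlled_space T \<kappa> \<gamma> \<eta> Z = {YY'. controlled_norm T \<kappa> \<gamma> \<eta> Z YY' < \<infinity>}"

(* Xi, Xi-hat, X-hat Xi, 1, X, X-hat, XX *)
datatype symbol = Sym_Xi | Sym_Xih | Sym_XhXi | Sym_One | Sym_X | Sym_Xh | Sym_XX

instance symbol :: finite
proof
  have "(UNIV :: symbol set) \<subseteq> {Sym_Xi, Sym_Xih, Sym_XhXi, Sym_One, Sym_X, Sym_Xh, Sym_XX}"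
    using symbol.exhaust by blast
  then show "finite (UNIV :: symbol set)"
    using finite_subset by blast
qed

(* The model space is real ^ symbol. The graded components are indexed by the symbols rather than by
   the values of the degree, which may coincide (for instance when \<alpha> = \<beta>). *)
type_synonym model_space = "real ^ symbol"

abbreviation basis_sym :: "symbol \<Rightarrow> model_space" where
  "basis_sym \<tau> \<equiv> axis \<tau> 1"

primrec deg :: "real \<Rightarrow> real \<Rightarrow> symbol \<Rightarrow> real" where
  "deg \<alpha> \<beta> Sym_Xi = \<alpha> - 1"
| "deg \<alpha> \<beta> Sym_Xih = \<beta> - 1"
| "deg \<alpha> \<beta> Sym_XhXi = \<alpha> + \<beta> - 1"
| "deg \<alpha> \<beta> Sym_One = 0"
| "deg \<alpha> \<beta> Sym_X = \<alpha>"
| "deg \<alpha> \<beta> Sym_Xh = \<beta>"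
| "deg \<alpha> \<beta> Sym_XX = \<alpha> + \<beta>"

primrec Gamma_sym :: "real \<Rightarrow> real \<Rightarrow> real \<Rightarrow> symbol \<Rightarrow> model_space" where
  "Gamma_sym h1 h2 h3 Sym_Xi = basis_sym Sym_Xi"
| "Gamma_sym h1 h2 h3 Sym_Xih = basis_sym Sym_Xih"
| "Gamma_sym h1 h2 h3 Sym_XhXi = basis_sym Sym_XhXi + h2 *\<^sub>R basis_sym Sym_Xi"
| "Gamma_sym h1 h2 h3 Sym_One = basis_sym Sym_One"
| "Gamma_sym h1 h2 h3 Sym_X = basis_sym Sym_X + h1 *\<^sub>R basis_sym Sym_One"
| "Gamma_sym h1 h2 h3 Sym_Xh = basis_sym Sym_Xh + h2 *\<^sub>R basis_sym Sym_One"
| "Gamma_sym h1 h2 h3 Sym_XX =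
     basis_sym Sym_XX + h2 *\<^sub>R basis_sym Sym_X + h3 *\<^sub>R basis_sym Sym_One"

(* Linear extension of Gamma_sym. Note the order of the arguments: Gamma X t s is \<Gamma>_{t,s}, which
   transports from s to t, whereas the increment h3 is XX s t. *)
definition Gamma ::
    "(real \<Rightarrow> real) \<times> (real \<Rightarrow> real) \<times> (real \<Rightarrow> real \<Rightarrow> real) \<Rightarrow> real \<Rightarrow> real \<Rightarrow> model_space \<Rightarrow> model_space" where
  "Gamma = (\<lambda>(X, Xh, XX) t s v.
     \<Sum>\<tau>\<in>UNIV. (v $ \<tau>) *\<^sub>R Gamma_sym (X t - X s) (Xh t - Xh s) (XX s t) \<tau>)"

definition modelled_norm ::
    "real \<Rightarrow> real \<Rightarrow> real \<Rightarrow> (real \<Rightarrow> real) \<times> (real \<Rightarrow> real) \<times> (real \<Rightarrow> real \<Rightarrow> real) \<Rightarrow>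
     real \<Rightarrow> real \<Rightarrow> (real \<Rightarrow> model_space) \<Rightarrow> ennreal" where
  "modelled_norm T \<alpha> \<beta> XXX \<delta> \<eta> F =
     (SUP \<tau>\<in>{\<tau>. deg \<alpha> \<beta> \<tau> < \<delta>}. SUP s\<in>{0<..T}.
        ennreal (\<bar>F s $ \<tau>\<bar> / (min s 1) powr (min (\<eta> - deg \<alpha> \<beta> \<tau>) 0)))
   + (SUP \<tau>\<in>{\<tau>. deg \<alpha> \<beta> \<tau> < \<delta>}. SUP (s, t)\<in>{(s, t). 0 < s \<and> s < t \<and> t \<le> T \<and> \<bar>t - s\<bar> \<le> s}.
        ennreal (\<bar>(F t - Gamma XXX t s (F s)) $ \<tau>\<bar>
                 / ((min s 1) powr (\<eta> - \<delta>) * \<bar>t - s\<bar> powr (\<delta> - deg \<alpha> \<beta> \<tau>))))"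

definition modelled_space ::
    "real \<Rightarrow> real \<Rightarrow> real \<Rightarrow> (real \<Rightarrow> real) \<times> (real \<Rightarrow> real) \<times> (real \<Rightarrow> real \<Rightarrow> real) \<Rightarrow>
     real \<Rightarrow> real \<Rightarrow> (real \<Rightarrow> model_space) set" where
  "modelled_space T \<alpha> \<beta> XXX \<delta> \<eta> = {F.
     (\<forall>s\<in>{0<..T}. \<forall>\<tau>. \<delta> \<le> deg \<alpha> \<beta> \<tau> \<longrightarrow> F s $ \<tau> = 0) \<and>
     modelled_norm T \<alpha> \<beta> XXX \<delta> \<eta> F < \<infinity>}"

(* lift_sym \<sigma> (Y, Y') is Y 1 + Y' \<sigma>; it is used with \<sigma> = X-hat and \<sigma> = X.
   At \<eta> = 0 and \<eta> = deg \<sigma> the lift of a controlled path need not be a modelled distribution: for Z = 0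
   and \<eta> = deg \<sigma>, the pair (0, ln) is controlled, but the \<sigma>-component ln is unbounded while its
   weight is 1. *)
definition lift_sym :: "symbol \<Rightarrow> (real \<Rightarrow> real) \<times> (real \<Rightarrow> real) \<Rightarrow> real \<Rightarrow> model_space" where
  "lift_sym \<sigma> = (\<lambda>(Y, Y') t. Y t *\<^sub>R basis_sym Sym_One + Y' t *\<^sub>R basis_sym \<sigma>)"

end

theory Submission
  imports Defs
begin

text \<open>
  Both halves of the statement concern one driving path \<open>Z\<close> of Hoelder exponent \<open>\<kappa>\<close> and one symbol
  \<open>\<sigma>\<close> of degree \<open>\<kappa>\<close>, so everything is proved for such a pair and applied to \<open>(Xh, \<beta>, Sym_Xh)\<close> and
  \<open>(X, \<alpha>, Sym_X)\<close>. On functions with values in the span of \<open>Sym_One\<close> and \<open>\<sigma>\<close>, the map \<open>Gamma\<close> adds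
  \<open>Y' s * (Z t - Z s)\<close> to the \<open>Sym_One\<close>-component. Hence the components of \<open>F t - Gamma XXX t s (F s)\<close>
  are exactly the remainder of \<open>Y\<close> and the increment of \<open>Y'\<close>, and the two norms bound the same two
  quantities, with three differences: the modelled norm only sees pairs with \<open>t \<le> 2 * s\<close>, its
  weights involve \<open>min s 1\<close> in place of \<open>s\<close>, and it also bounds the size of the components. The
  second difference costs a constant depending on \<open>T\<close>, because \<open>s\<close> and \<open>min s 1\<close> are comparable on
  \<open>(0, T]\<close>. The other two are dealt with by moving along dyadic scales.

  Size of the components: halving repeatedly the distance to \<open>0\<close>, starting from \<open>T\<close>, changes \<open>Y'\<close> at
  scale \<open>s\<close> by at most a multiple of \<open>s powr (\<eta> - \<kappa>)\<close>, and the sum of these changes is geometric. It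
  is dominated by its last term if \<open>\<eta> < \<kappa>\<close> and bounded if \<open>\<eta> > \<kappa>\<close>, which is the weight in the
  modelled norm; for \<open>\<eta> = \<kappa>\<close> it is logarithmic, whence the exclusion of this value. The bound on \<open>Y'\<close>
  makes the changes of \<open>Y\<close> at most a multiple of \<open>s powr min \<eta> \<kappa>\<close>, and the same summation applies,
  with \<open>\<eta> = 0\<close> as the exceptional value. This is \<open>size_bound_if_controlled\<close>.

  Distant pairs: if \<open>t > 2 * s\<close>, halving \<open>t\<close> until it is within a factor \<open>2\<close> of \<open>s\<close> decomposes the
  increment from \<open>s\<close> to \<open>t\<close> into increments over near pairs. All the weights are at most the one at
  \<open>s\<close>, since \<open>\<eta> - (\<gamma> + \<kappa>) \<le> 0\<close>, and the powers of the lengths again sum to a multiple of the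
  largest, \<open>t\<close>, which is comparable to \<open>t - s\<close>. Remainders are not additive, but their defect
  \<open>(Y' u - Y' s) * (Z t - Z u)\<close> is of the same order. This is \<open>increment_bound_all_if_near\<close>.
\<close>

section \<open>Telescoping along dyadic scales\<close>

text \<open>
  Steps from \<open>s\<close> to \<open>2 * s\<close> are iterated until \<open>T\<close> is reached. The potential
  \<open>\<Phi> s = (D - s powr p) / (2 powr p - 1)\<close> satisfies \<open>\<Phi> s - \<Phi> (2 * s) = s powr p\<close>, so it carries the sum
  of the geometric series, with one formula for both signs of \<open>p\<close>.
\<close>

lemma backward_telescope:
  fixes g :: "real \<Rightarrow> real"
  assumes "p \<noteq> 0" "0 \<le> B" "0 < s" "s \<le> T"
    and step: "\<And>s t. \<lbrakk>0 < s; s < t; t \<le> T; t \<le> 2 * s\<rbrakk> \<Longrightarrow> g s \<le> g t + B * s powr p"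
  shows "g s \<le> g T + B * (((if p > 0 then (2 * T) powr p else 0) - s powr p) / (2 powr p - 1))"
proof -
  define D where "D = (if p > 0 then (2 * T) powr p else 0)"
  define \<Phi> where "\<Phi> s = (D - s powr p) / (2 powr p - 1)" for s
  have T: "0 < T" using assms by simp
  have sg: "(p > 0 \<and> 2 powr p > 1) \<or> (p < 0 \<and> 2 powr p < (1::real))"
    using \<open>p \<noteq> 0\<close> powr_less_cancel_iff[of 2 0 p] powr_less_cancel_iff[of 2 p 0] by force
  have dbl: "\<Phi> s = \<Phi> (2 * s) + s powr p" if "0 < s" for s
    using sg that by (auto simp: \<Phi>_def powr_mult field_simps)
  \<comment> \<open>The value of \<open>D\<close> is chosen so that the last, possibly shorter, step is covered too.\<close>
  have last: "s powr p \<le> \<Phi> s" if "0 < s" "s \<le> T" for s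
  proof (cases "p > 0")
    case True
    have "s powr p * 2 powr p \<le> T powr p * 2 powr p"
      using that True by (intro mult_right_mono powr_mono2) auto
    then show ?thesis
      using sg True T by (auto simp: \<Phi>_def D_def powr_mult field_simps)
  next
    case False
    then have "2 powr p < (1::real)" "p < 0" using sg by auto
    then have "s powr p * (1 - 2 powr p) \<le> s powr p * 1"
      by (intro mult_left_mono) auto
    with \<open>2 powr p < 1\<close> False show ?thesis
      by (auto simp: \<Phi>_def D_def field_simps)
  qed
  have "g s \<le> g T + B * \<Phi> s" if "0 < s" "s \<le> T" "T \<le> 2 ^ n * s" for s n
    using that
  proof (induction n arbitrary: s)
    case 0
    then have "s = T" by simp
    moreover have "0 \<le> B * \<Phi> T"
      using last[OF T] \<open>0 \<le> B\<close> by (meson mult_nonneg_nonneg order_refl order_trans powr_ge_zero)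
    ultimately show ?case by simp
  next
    case (Suc n)
    show ?case
    proof (cases "2 * s \<le> T")
      case True
      have "g s \<le> g (2 * s) + B * s powr p"
        using step[of s "2 * s"] Suc.prems True by simp
      also have "\<dots> \<le> g T + B * \<Phi> (2 * s) + B * s powr p"
        using Suc.IH[of "2 * s"] Suc.prems True by (simp add: mult.assoc mult.left_commute)
      also have "\<dots> = g T + B * \<Phi> s"
        using dbl[of s] Suc.prems by (simp add: algebra_simps)
      finally show ?thesis .
    next
      case False
      have *: "B * s powr p \<le> B * \<Phi> s" "0 \<le> B * \<Phi> s"
        using last[of s] Suc.prems \<open>0 \<le> B\<close> mult_left_mono order_trans[OF powr_ge_zero last[of s]]
        by auto
      show ?thesis
      proof (cases "s = T")
        case False
        then have "g s \<le> g T + B * s powr p"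
          using step[of s T] Suc.prems \<open>\<not> 2 * s \<le> T\<close> by simp
        with * show ?thesis by linarith
      qed (use * in auto)
    qed
  qed
  moreover obtain n where "T / s < 2 ^ n"
    using real_arch_pow[of 2 "T / s"] by auto
  then have "T \<le> 2 ^ n * s"
    using \<open>0 < s\<close> by (simp add: field_simps)
  ultimately show ?thesis
    using assms by (auto simp: \<Phi>_def D_def)
qed

text \<open>
  For \<open>p > 0\<close> the accumulated error is bounded uniformly in \<open>s\<close>, for \<open>p < 0\<close> it is of the order of the
  error made in the step at \<open>s\<close>. The constant has to be independent of \<open>g\<close> and \<open>B\<close>.
\<close>

lemma backward_telescope_bound:
  fixes T p :: real
  assumes "0 < T" "p \<noteq> 0"
  obtains c where "0 < c" and
    "\<And>(g :: real \<Rightarrow> real) B s. \<lbrakk>0 \<le> B; 0 < s; s \<le> T;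
        \<And>s t. \<lbrakk>0 < s; s < t; t \<le> T; t \<le> 2 * s\<rbrakk> \<Longrightarrow> g s \<le> g t + B * s powr p\<rbrakk>
      \<Longrightarrow> g s \<le> g T + c * B * s powr min p 0"
proof (cases "p > 0")
  case True
  then have 2: "2 powr p > (1::real)"
    by simp
  show thesis
  proof (rule that)
    show "0 < (2 * T) powr p / (2 powr p - 1)"
      using 2 assms by simp
    fix g :: "real \<Rightarrow> real" and B s :: real
    assume B: "0 \<le> B" "0 < s" "s \<le> T"
      and "\<And>s t. \<lbrakk>0 < s; s < t; t \<le> T; t \<le> 2 * s\<rbrakk> \<Longrightarrow> g s \<le> g t + B * s powr p"
    then have "g s \<le> g T + B * (((2 * T) powr p - s powr p) / (2 powr p - 1))"
      using backward_telescope[of p B s T g] True by auto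
    moreover have "((2 * T) powr p - s powr p) / (2 powr p - 1) \<le> (2 * T) powr p / (2 powr p - 1)"
      using 2 by (intro divide_right_mono) auto
    from mult_left_mono[OF this B(1)]
    have "B * (((2 * T) powr p - s powr p) / (2 powr p - 1)) \<le> B * ((2 * T) powr p / (2 powr p - 1))" .
    ultimately show "g s \<le> g T + (2 * T) powr p / (2 powr p - 1) * B * s powr min p 0"
      using True B by (simp add: min_def mult.commute)
  qed
next
  case False
  with assms have "p < 0" by simp
  then have 2: "2 powr p < (1::real)"
    using powr_less_cancel_iff[of 2 p 0] by simp
  show thesis
  proof (rule that)
    show "0 < 1 / (1 - 2 powr p :: real)"
      using 2 by simp
    fix g :: "real \<Rightarrow> real" and B s :: real
    assume B: "0 \<le> B" "0 < s" "s \<le> T"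
      and "\<And>s t. \<lbrakk>0 < s; s < t; t \<le> T; t \<le> 2 * s\<rbrakk> \<Longrightarrow> g s \<le> g t + B * s powr p"
    then have "g s \<le> g T + B * ((0 - s powr p) / (2 powr p - 1))"
      using backward_telescope[of p B s T g] \<open>p < 0\<close> by auto
    moreover have "(0 - s powr p) / (2 powr p - 1) = s powr p / (1 - 2 powr p)"
      using minus_divide_divide[of "s powr p" "1 - 2 powr p"] by simp
    ultimately have "g s \<le> g T + B * (s powr p / (1 - 2 powr p))"
      by (simp only:)
    then show "g s \<le> g T + 1 / (1 - 2 powr p) * B * s powr min p 0"
      using \<open>p < 0\<close> by (simp add: min_def mult.commute)
  qed
qed

text \<open>
  Here the scale at which the step is made grows, and with \<open>p > 0\<close> the last step dominates. The
  constant \<open>c = 2 powr p / (2 powr p - 1)\<close> is the sum of the series of the \<open>2 powr (- p * k)\<close>, that is,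
  the solution of \<open>c / 2 powr p + 1 = c\<close>.
\<close>

lemma forward_telescope:
  fixes g :: "real \<Rightarrow> real"
  assumes "0 < p" "0 \<le> B" "0 < s" "s < t" "t \<le> T"
    and near: "\<And>t. \<lbrakk>s < t; t \<le> T; t \<le> 2 * s\<rbrakk> \<Longrightarrow> g t \<le> B * t powr p"
    and half: "\<And>t. \<lbrakk>2 * s < t; t \<le> T\<rbrakk> \<Longrightarrow> g t \<le> g (t / 2) + B * t powr p"
  shows "g t \<le> 2 powr p / (2 powr p - 1) * B * t powr p"
proof -
  have 2: "2 powr p > (1::real)"
    using \<open>0 < p\<close> by simp
  define c where "c = 2 powr p / (2 powr p - 1 :: real)"
  have c: "1 \<le> c"
    using 2 by (simp add: c_def)
  have "c / 2 powr p = 1 / (2 powr p - 1)"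
    by (simp add: c_def)
  then have c_step: "c / 2 powr p + 1 = c"
    using 2 \<open>0 < p\<close> by (simp add: c_def divide_simps)
  have "g t \<le> c * B * t powr p" if "s < t" "t \<le> T" "t \<le> 2 ^ n * s" for t n
    using that
  proof (induction n arbitrary: t)
    case (Suc n)
    show ?case
    proof (cases "t \<le> 2 * s")
      case True
      have "B * t powr p \<le> c * (B * t powr p)"
        using c \<open>0 \<le> B\<close> mult_right_mono[of 1 c "B * t powr p"] by simp
      with near[of t] Suc.prems True show ?thesis by (simp add: mult.assoc)
    next
      case False
      have "g t \<le> g (t / 2) + B * t powr p"
        using half[of t] False Suc.prems by simp
      also have "\<dots> \<le> c * B * (t / 2) powr p + B * t powr p"
        using Suc.IH[of "t / 2"] False Suc.prems \<open>0 < s\<close> by simp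
      also have "\<dots> = (c / 2 powr p + 1) * (B * t powr p)"
        using Suc.prems \<open>0 < s\<close> by (simp add: powr_divide algebra_simps)
      finally show ?thesis
        by (simp add: c_step mult.assoc)
    qed
  qed auto
  moreover obtain n where "t / s < 2 ^ n"
    using real_arch_pow[of 2 "t / s"] by auto
  then have "t \<le> 2 ^ n * s"
    using \<open>0 < s\<close> by (simp add: field_simps)
  ultimately show ?thesis
    using assms by (auto simp: c_def)
qed

section \<open>The norms as families of inequalities\<close>

abbreviation all_pairs :: "real \<Rightarrow> (real \<times> real) set" where
  "all_pairs T \<equiv> {(s, t). 0 < s \<and> s < t \<and> t \<le> T}"

abbreviation near_pairs :: "real \<Rightarrow> (real \<times> real) set" where
  "near_pairs T \<equiv> {(s, t). 0 < s \<and> s < t \<and> t \<le> T \<and> \<bar>t - s\<bar> \<le> s}"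

text \<open>
  Both norms contain suprema of the increment of \<open>Y'\<close> and of the remainder of \<open>Y\<close>. The set \<open>I\<close> of pairs
  and the weight \<open>w\<close> are the only respects in which they differ.
\<close>

definition increment_bound ::
    "(real \<times> real) set \<Rightarrow> (real \<Rightarrow> real) \<Rightarrow> real \<Rightarrow> real \<Rightarrow> (real \<Rightarrow> real) \<Rightarrow>
     (real \<Rightarrow> real) \<Rightarrow> (real \<Rightarrow> real) \<Rightarrow> real \<Rightarrow> bool" where
  "increment_bound I w \<kappa> \<gamma> Z Y Y' N \<longleftrightarrow>
     (\<forall>(s, t)\<in>I. \<bar>Y' t - Y' s\<bar> \<le> N * (w s * \<bar>t - s\<bar> powr \<gamma>) \<and>
        \<bar>Y t - Y s - Y' s * (Z t - Z s)\<bar> \<le> N * (w s * \<bar>t - s\<bar> powr (\<gamma> + \<kappa>)))"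

definition size_bound ::
    "real \<Rightarrow> real \<Rightarrow> real \<Rightarrow> (real \<Rightarrow> real) \<Rightarrow> (real \<Rightarrow> real) \<Rightarrow> real \<Rightarrow> bool" where
  "size_bound T \<kappa> \<eta> Y Y' N \<longleftrightarrow>
     (\<forall>s\<in>{0<..T}. \<bar>Y s\<bar> \<le> N * min s 1 powr min \<eta> 0 \<and>
        \<bar>Y' s\<bar> \<le> N * min s 1 powr min (\<eta> - \<kappa>) 0)"

lemma controlled_norm_le:
  assumes "0 \<le> N"
    and "increment_bound (all_pairs T) (\<lambda>s. s powr (\<eta> - (\<gamma> + \<kappa>))) \<kappa> \<gamma> Z Y Y' N"
  shows "controlled_norm T \<kappa> \<gamma> \<eta> Z (Y, Y') \<le> ennreal (2 * N)"
proof -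
  have "controlled_norm T \<kappa> \<gamma> \<eta> Z (Y, Y') \<le> ennreal N + ennreal N"
    unfolding controlled_norm_def prod.case
    using assms by (intro add_mono SUP_least)
      (auto intro!: ennreal_leI simp: increment_bound_def pos_divide_le_eq)
  then show ?thesis
    using \<open>0 \<le> N\<close> by (simp flip: ennreal_plus)
qed

lemma increment_bound_if_controlled_norm:
  assumes "0 \<le> N" and N: "controlled_norm T \<kappa> \<gamma> \<eta> Z (Y, Y') \<le> ennreal N"
  shows "increment_bound (all_pairs T) (\<lambda>s. s powr (\<eta> - (\<gamma> + \<kappa>))) \<kappa> \<gamma> Z Y Y' N"
  unfolding increment_bound_def
proof (safe)
  fix s t :: real
  assume st: "0 < s" "s < t" "t \<le> T"
  have "ennreal (\<bar>Y' t - Y' s\<bar> / (s powr (\<eta> - (\<gamma> + \<kappa>)) * \<bar>t - s\<bar> powr \<gamma>)) \<le> ennreal N"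
    by (rule order_trans[OF _ N], unfold controlled_norm_def prod.case,
        rule add_increasing2, simp, rule SUP_upper2[of "(s, t)"]) (use st in auto)
  then show "\<bar>Y' t - Y' s\<bar> \<le> N * (s powr (\<eta> - (\<gamma> + \<kappa>)) * \<bar>t - s\<bar> powr \<gamma>)"
    using st \<open>0 \<le> N\<close> by (simp add: pos_divide_le_eq)
  have "ennreal (\<bar>Y t - Y s - Y' s * (Z t - Z s)\<bar> /
      (s powr (\<eta> - (\<gamma> + \<kappa>)) * \<bar>t - s\<bar> powr (\<gamma> + \<kappa>))) \<le> ennreal N"
    by (rule order_trans[OF _ N], unfold controlled_norm_def prod.case,
        rule add_increasing, simp, rule SUP_upper2[of "(s, t)"]) (use st in auto)
  then show "\<bar>Y t - Y s - Y' s * (Z t - Z s)\<bar>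
      \<le> N * (s powr (\<eta> - (\<gamma> + \<kappa>)) * \<bar>t - s\<bar> powr (\<gamma> + \<kappa>))"
    using st \<open>0 \<le> N\<close> by (simp add: pos_divide_le_eq)
qed

definition supported_on :: "real \<Rightarrow> symbol \<Rightarrow> (real \<Rightarrow> model_space) \<Rightarrow> bool" where
  "supported_on T \<sigma> F \<longleftrightarrow>
     (\<forall>s\<in>{0<..T}. \<forall>\<tau>. \<tau> \<noteq> Sym_One \<and> \<tau> \<noteq> \<sigma> \<longrightarrow> F s $ \<tau> = 0)"

text \<open>
  The action of the model on the span of \<open>Sym_One\<close> and \<open>\<sigma>\<close>, taken as a hypothesis so that
  \<open>(Xh, Sym_Xh)\<close> and \<open>(X, Sym_X)\<close> are treated at once.
\<close>

definition translates ::
    "(real \<Rightarrow> real) \<times> (real \<Rightarrow> real) \<times> (real \<Rightarrow> real \<Rightarrow> real) \<Rightarrow> symbol \<Rightarrow> (real \<Rightarrow> real) \<Rightarrow> bool" where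
  "translates XXX \<sigma> Z \<longleftrightarrow> \<sigma> \<noteq> Sym_One \<and>
     (\<forall>s t v. (\<forall>\<tau>. \<tau> \<noteq> Sym_One \<and> \<tau> \<noteq> \<sigma> \<longrightarrow> v $ \<tau> = 0) \<longrightarrow>
        Gamma XXX t s v = v + (v $ \<sigma> * (Z t - Z s)) *\<^sub>R basis_sym Sym_One)"

lemma UNIV_symbol:
  "(UNIV :: symbol set) = {Sym_Xi, Sym_Xih, Sym_XhXi, Sym_One, Sym_X, Sym_Xh, Sym_XX}"
  using symbol.exhaust by blast

lemma translates_Xh: "translates (X, Xh, XX) Sym_Xh Xh"
proof -
  have "Gamma (X, Xh, XX) t s v $ \<rho> = (v + (v $ Sym_Xh * (Xh t - Xh s)) *\<^sub>R basis_sym Sym_One) $ \<rho>"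
    if "\<forall>\<tau>. \<tau> \<noteq> Sym_One \<and> \<tau> \<noteq> Sym_Xh \<longrightarrow> v $ \<tau> = 0" for s t v \<rho>
    using that by (cases \<rho>) (simp_all add: Gamma_def UNIV_symbol axis_def)
  then show ?thesis
    by (simp add: translates_def vec_eq_iff)
qed

lemma translates_X: "translates (X, Xh, XX) Sym_X X"
proof -
  have "Gamma (X, Xh, XX) t s v $ \<rho> = (v + (v $ Sym_X * (X t - X s)) *\<^sub>R basis_sym Sym_One) $ \<rho>"
    if "\<forall>\<tau>. \<tau> \<noteq> Sym_One \<and> \<tau> \<noteq> Sym_X \<longrightarrow> v $ \<tau> = 0" for s t v \<rho>
    using that by (cases \<rho>) (simp_all add: Gamma_def UNIV_symbol axis_def)
  then show ?thesis
    by (simp add: translates_def vec_eq_iff)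
qed

lemma Gamma_increment:
  assumes "translates XXX \<sigma> Z" "supported_on T \<sigma> F" "0 < s" "s \<le> T" "0 < t" "t \<le> T"
  shows "(F t - Gamma XXX t s (F s)) $ \<tau> =
    (if \<tau> = Sym_One then F t $ Sym_One - F s $ Sym_One - F s $ \<sigma> * (Z t - Z s)
     else if \<tau> = \<sigma> then F t $ \<sigma> - F s $ \<sigma> else 0)"
proof -
  have "Gamma XXX t s (F s) = F s + (F s $ \<sigma> * (Z t - Z s)) *\<^sub>R basis_sym Sym_One"
    using assms unfolding translates_def supported_on_def by auto
  with assms show ?thesis
    by (auto simp: axis_def translates_def supported_on_def)
qed

text \<open>
  Only the components at \<open>Sym_One\<close> and \<open>\<sigma>\<close> contribute to the suprema over symbols, all others vanish
  by \<open>supported_on\<close> and \<open>Gamma_increment\<close>. At these two, the exponents \<open>\<gamma> + \<kappa> - deg \<alpha> \<beta> \<tau>\<close> are \<open>\<gamma> + \<kappa>\<close> and \<open>\<gamma>\<close>.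
\<close>

lemma modelled_norm_le:
  assumes XXX: "translates XXX \<sigma> Z" and F: "supported_on T \<sigma> F" and deg: "deg \<alpha> \<beta> \<sigma> = \<kappa>"
    and "0 \<le> N"
    and size: "size_bound T \<kappa> \<eta> (\<lambda>s. F s $ Sym_One) (\<lambda>s. F s $ \<sigma>) N"
    and incr: "increment_bound (near_pairs T) (\<lambda>s. min s 1 powr (\<eta> - (\<gamma> + \<kappa>))) \<kappa> \<gamma> Z
      (\<lambda>s. F s $ Sym_One) (\<lambda>s. F s $ \<sigma>) N"
  shows "modelled_norm T \<alpha> \<beta> XXX (\<gamma> + \<kappa>) \<eta> F \<le> ennreal (2 * N)"
proof -
  have "\<bar>F s $ \<tau>\<bar> / min s 1 powr min (\<eta> - deg \<alpha> \<beta> \<tau>) 0 \<le> N" if "0 < s" "s \<le> T" for s \<tau>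
  proof -
    have "F s $ \<tau> = 0" if "\<tau> \<noteq> Sym_One" "\<tau> \<noteq> \<sigma>"
      using F that \<open>0 < s\<close> \<open>s \<le> T\<close> by (simp add: supported_on_def)
    then show ?thesis
      using size that deg \<open>0 \<le> N\<close>
      by (cases "\<tau> = Sym_One"; cases "\<tau> = \<sigma>") (auto simp: size_bound_def pos_divide_le_eq)
  qed
  moreover have "\<bar>(F t - Gamma XXX t s (F s)) $ \<tau>\<bar> /
      (min s 1 powr (\<eta> - (\<gamma> + \<kappa>)) * \<bar>t - s\<bar> powr (\<gamma> + \<kappa> - deg \<alpha> \<beta> \<tau>)) \<le> N"
    if "0 < s" "s < t" "t \<le> T" "\<bar>t - s\<bar> \<le> s" for s t \<tau>
    unfolding Gamma_increment[OF XXX F \<open>0 < s\<close> order_trans[OF less_imp_le[OF \<open>s < t\<close>] \<open>t \<le> T\<close>]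
        order_less_trans[OF \<open>0 < s\<close> \<open>s < t\<close>] \<open>t \<le> T\<close>]
    using incr that deg \<open>0 \<le> N\<close> by (auto simp: increment_bound_def pos_divide_le_eq)
  ultimately have "modelled_norm T \<alpha> \<beta> XXX (\<gamma> + \<kappa>) \<eta> F \<le> ennreal N + ennreal N"
    unfolding modelled_norm_def
    by (intro add_mono SUP_least) (auto intro!: ennreal_leI)
  then show ?thesis
    using \<open>0 \<le> N\<close> by (simp flip: ennreal_plus)
qed

text \<open>
  Positivity of \<open>\<kappa>\<close> and \<open>\<gamma>\<close> puts the degrees of \<open>Sym_One\<close> and \<open>\<sigma>\<close> below \<open>\<gamma> + \<kappa>\<close>, so that both symbols take
  part in the suprema.
\<close>

lemma bounds_if_modelled_norm:
  assumes XXX: "translates XXX \<sigma> Z" and F: "supported_on T \<sigma> F" and deg: "deg \<alpha> \<beta> \<sigma> = \<kappa>"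
    and pos: "0 < \<kappa>" "0 < \<gamma>" "0 \<le> N" and N: "modelled_norm T \<alpha> \<beta> XXX (\<gamma> + \<kappa>) \<eta> F \<le> ennreal N"
  shows "size_bound T \<kappa> \<eta> (\<lambda>s. F s $ Sym_One) (\<lambda>s. F s $ \<sigma>) N"
    and "increment_bound (near_pairs T) (\<lambda>s. min s 1 powr (\<eta> - (\<gamma> + \<kappa>))) \<kappa> \<gamma> Z
      (\<lambda>s. F s $ Sym_One) (\<lambda>s. F s $ \<sigma>) N"
proof -
  have "\<sigma> \<noteq> Sym_One"
    using XXX by (simp add: translates_def)
  have size: "\<bar>F s $ \<tau>\<bar> \<le> N * min s 1 powr min (\<eta> - deg \<alpha> \<beta> \<tau>) 0"
    if "0 < s" "s \<le> T" "deg \<alpha> \<beta> \<tau> < \<gamma> + \<kappa>" for s \<tau>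
  proof -
    have "ennreal (\<bar>F s $ \<tau>\<bar> / min s 1 powr min (\<eta> - deg \<alpha> \<beta> \<tau>) 0) \<le> ennreal N"
      by (rule order_trans[OF _ N], unfold modelled_norm_def, rule add_increasing2, simp,
          rule SUP_upper2[of \<tau>], use that in simp, rule SUP_upper2[of s]) (use that in auto)
    then show ?thesis
      using that pos by (simp add: pos_divide_le_eq)
  qed
  show "size_bound T \<kappa> \<eta> (\<lambda>s. F s $ Sym_One) (\<lambda>s. F s $ \<sigma>) N"
    unfolding size_bound_def using size[of _ Sym_One] size[of _ \<sigma>] deg pos by auto
  have incr: "\<bar>(F t - Gamma XXX t s (F s)) $ \<tau>\<bar> \<le>
      N * (min s 1 powr (\<eta> - (\<gamma> + \<kappa>)) * \<bar>t - s\<bar> powr (\<gamma> + \<kappa> - deg \<alpha> \<beta> \<tau>))"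
    if "0 < s" "s < t" "t \<le> T" "\<bar>t - s\<bar> \<le> s" "deg \<alpha> \<beta> \<tau> < \<gamma> + \<kappa>" for s t \<tau>
  proof -
    have "ennreal (\<bar>(F t - Gamma XXX t s (F s)) $ \<tau>\<bar> /
      (min s 1 powr (\<eta> - (\<gamma> + \<kappa>)) * \<bar>t - s\<bar> powr (\<gamma> + \<kappa> - deg \<alpha> \<beta> \<tau>))) \<le> ennreal N"
      by (rule order_trans[OF _ N], unfold modelled_norm_def, rule add_increasing, simp,
          rule SUP_upper2[of \<tau>], use that in simp, rule SUP_upper2[of "(s, t)"]) (use that in auto)
    then show ?thesis
      using that pos by (simp add: pos_divide_le_eq del: vector_minus_component)
  qed
  show "increment_bound (near_pairs T) (\<lambda>s. min s 1 powr (\<eta> - (\<gamma> + \<kappa>))) \<kappa> \<gamma> Z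
      (\<lambda>s. F s $ Sym_One) (\<lambda>s. F s $ \<sigma>) N"
    unfolding increment_bound_def
  proof (safe)
    fix s t :: real
    assume st: "0 < s" "s < t" "t \<le> T" "\<bar>t - s\<bar> \<le> s"
    note eq = Gamma_increment[OF XXX F, of s t]
    show "\<bar>F t $ \<sigma> - F s $ \<sigma>\<bar> \<le> N * (min s 1 powr (\<eta> - (\<gamma> + \<kappa>)) * \<bar>t - s\<bar> powr \<gamma>)"
      using incr[OF st, of \<sigma>] eq[of \<sigma>] st deg pos \<open>\<sigma> \<noteq> Sym_One\<close> by simp
    show "\<bar>F t $ Sym_One - F s $ Sym_One - F s $ \<sigma> * (Z t - Z s)\<bar>
        \<le> N * (min s 1 powr (\<eta> - (\<gamma> + \<kappa>)) * \<bar>t - s\<bar> powr (\<gamma> + \<kappa>))"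
      using incr[OF st, of Sym_One] eq[of Sym_One] st pos by simp
  qed
qed

section \<open>Size and increments of controlled paths\<close>

lemma powr_mult_increment_le:
  fixes s t a e :: real
  assumes "0 < s" "s < t" "t \<le> 2 * s" "0 \<le> a"
  shows "s powr e * \<bar>t - s\<bar> powr a \<le> s powr (e + a)"
proof -
  have "\<bar>t - s\<bar> powr a \<le> s powr a"
    using assms by (intro powr_mono2) auto
  then show ?thesis
    by (simp add: powr_add mult_left_mono)
qed

lemma powr_le_lower_exponent:
  fixes s T p a :: real
  assumes "0 < s" "s \<le> T" "p \<le> a"
  shows "s powr a \<le> T powr (a - p) * s powr p"
proof -
  have "s powr a = s powr (a - p) * s powr p"
    by (simp flip: powr_add)
  also have "\<dots> \<le> T powr (a - p) * s powr p"
    using assms by (intro mult_right_mono powr_mono2) auto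
  finally show ?thesis .
qed

lemma holder_bound_abs:
  assumes "holder_bound T \<kappa> K Z" "0 \<le> s" "s \<le> T" "0 \<le> t" "t \<le> T"
  shows "\<bar>Z t - Z s\<bar> \<le> \<bar>K\<bar> * \<bar>t - s\<bar> powr \<kappa>"
proof -
  have "\<bar>Z t - Z s\<bar> \<le> K * \<bar>t - s\<bar> powr \<kappa>"
    using assms by (auto simp: holder_bound_def)
  also have "\<dots> \<le> \<bar>K\<bar> * \<bar>t - s\<bar> powr \<kappa>"
    by (intro mult_right_mono) auto
  finally show ?thesis .
qed

text \<open>
  The telescoping is applied first to \<open>Y'\<close>, with exponent \<open>\<eta> - \<kappa>\<close>, and then to \<open>Y\<close>. In a dyadic step
  \<open>Y\<close> changes by the remainder, of order \<open>s powr \<eta>\<close>, and by \<open>Y' s * (Z t - Z s)\<close>, whose order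
  \<open>s powr min (\<eta> - \<kappa>) 0 * s powr \<kappa> = s powr min \<eta> \<kappa>\<close> follows from the first application. Hence the
  exponent \<open>min \<eta> \<kappa>\<close> in the second one.
\<close>

lemma size_bound_if_controlled:
  fixes T \<kappa> \<gamma> \<eta> K :: real
  assumes "0 < T" "0 < \<kappa>" "0 < \<gamma>" "\<eta> \<noteq> 0" "\<eta> \<noteq> \<kappa>"
  obtains C where "0 < C" and
    "\<And>Z Y Y' N. \<lbrakk>0 \<le> N; holder_bound T \<kappa> K Z;
        increment_bound (all_pairs T) (\<lambda>s. s powr (\<eta> - (\<gamma> + \<kappa>))) \<kappa> \<gamma> Z Y Y' N\<rbrakk>
      \<Longrightarrow> size_bound T \<kappa> \<eta> Y Y' (C * (\<bar>Y T\<bar> + \<bar>Y' T\<bar> + N))"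
proof -
  define p where "p = min \<eta> \<kappa>"
  define q where "q = min (\<eta> - \<kappa>) 0"
  have "p \<noteq> 0"
    using assms by (simp add: p_def min_def)
  obtain c\<^sub>1 where c1: "0 < c\<^sub>1" and tele1:
    "\<And>(g :: real \<Rightarrow> real) B s. \<lbrakk>0 \<le> B; 0 < s; s \<le> T;
        \<And>s t. \<lbrakk>0 < s; s < t; t \<le> T; t \<le> 2 * s\<rbrakk> \<Longrightarrow> g s \<le> g t + B * s powr (\<eta> - \<kappa>)\<rbrakk>
      \<Longrightarrow> g s \<le> g T + c\<^sub>1 * B * s powr q"
    using backward_telescope_bound[of T "\<eta> - \<kappa>"] assms unfolding q_def by auto
  obtain c\<^sub>2 where c2: "0 < c\<^sub>2" and tele2:
    "\<And>(g :: real \<Rightarrow> real) B s. \<lbrakk>0 \<le> B; 0 < s; s \<le> T;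
        \<And>s t. \<lbrakk>0 < s; s < t; t \<le> T; t \<le> 2 * s\<rbrakk> \<Longrightarrow> g s \<le> g t + B * s powr p\<rbrakk>
      \<Longrightarrow> g s \<le> g T + c\<^sub>2 * B * s powr min p 0"
    using backward_telescope_bound[OF \<open>0 < T\<close> \<open>p \<noteq> 0\<close>] by blast
  define L where "L = \<bar>K\<bar> * T powr (\<kappa> - p) + c\<^sub>1 * \<bar>K\<bar> + T powr (\<eta> - p)"
  have "0 \<le> L"
    using c1 by (simp add: L_def)
  define C where "C = 1 + c\<^sub>1 + c\<^sub>2 * L"
  show thesis
  proof (rule that)
    show "0 < C"
      using c1 c2 \<open>0 \<le> L\<close> by (simp add: C_def add_pos_nonneg)
    fix Z Y Y' :: "real \<Rightarrow> real" and N :: real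
    assume "0 \<le> N" and Z: "holder_bound T \<kappa> K Z"
      and N: "increment_bound (all_pairs T) (\<lambda>s. s powr (\<eta> - (\<gamma> + \<kappa>))) \<kappa> \<gamma> Z Y Y' N"
    define A where "A = \<bar>Y T\<bar> + \<bar>Y' T\<bar> + N"
    have A: "0 \<le> A" "N \<le> A" "\<bar>Y T\<bar> \<le> A" "\<bar>Y' T\<bar> \<le> A"
      using \<open>0 \<le> N\<close> by (auto simp: A_def)
    have incr': "\<bar>Y' t - Y' s\<bar> \<le> N * s powr (\<eta> - \<kappa>)"
      and incr: "\<bar>Y t - Y s - Y' s * (Z t - Z s)\<bar> \<le> N * s powr \<eta>"
      if "0 < s" "s < t" "t \<le> T" "t \<le> 2 * s" for s t
    proof -
      have "\<bar>Y' t - Y' s\<bar> \<le> N * (s powr (\<eta> - (\<gamma> + \<kappa>)) * \<bar>t - s\<bar> powr \<gamma>)"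
        using N that by (auto simp: increment_bound_def)
      also have "\<dots> \<le> N * s powr (\<eta> - \<kappa>)"
        using powr_mult_increment_le[of s t \<gamma> "\<eta> - (\<gamma> + \<kappa>)"] that assms \<open>0 \<le> N\<close>
        by (intro mult_left_mono) auto
      finally show "\<bar>Y' t - Y' s\<bar> \<le> N * s powr (\<eta> - \<kappa>)" .
      have "\<bar>Y t - Y s - Y' s * (Z t - Z s)\<bar> \<le> N * (s powr (\<eta> - (\<gamma> + \<kappa>)) * \<bar>t - s\<bar> powr (\<gamma> + \<kappa>))"
        using N that by (auto simp: increment_bound_def)
      also have "\<dots> \<le> N * s powr \<eta>"
        using powr_mult_increment_le[of s t "\<gamma> + \<kappa>" "\<eta> - (\<gamma> + \<kappa>)"] that assms \<open>0 \<le> N\<close>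
        by (intro mult_left_mono) auto
      finally show "\<bar>Y t - Y s - Y' s * (Z t - Z s)\<bar> \<le> N * s powr \<eta>" .
    qed
    have Y': "\<bar>Y' s\<bar> \<le> A + c\<^sub>1 * A * s powr q" if s: "0 < s" "s \<le> T" for s
    proof -
      have "\<bar>Y' s\<bar> \<le> \<bar>Y' T\<bar> + c\<^sub>1 * N * s powr q"
      proof (rule tele1[of N s "\<lambda>s. \<bar>Y' s\<bar>", OF \<open>0 \<le> N\<close> s])
        fix s t :: real
        assume "0 < s" "s < t" "t \<le> T" "t \<le> 2 * s"
        from incr'[OF this] show "\<bar>Y' s\<bar> \<le> \<bar>Y' t\<bar> + N * s powr (\<eta> - \<kappa>)" by simp
      qed
      also have "\<dots> \<le> A + c\<^sub>1 * A * s powr q"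
        using A c1 by (intro add_mono mult_right_mono mult_left_mono) auto
      finally show ?thesis .
    qed
    have Y: "\<bar>Y s\<bar> \<le> A + c\<^sub>2 * (A * L) * s powr min \<eta> 0" if s: "0 < s" "s \<le> T" for s
    proof -
      have "\<bar>Y s\<bar> \<le> \<bar>Y T\<bar> + c\<^sub>2 * (A * L) * s powr min p 0"
      proof (rule tele2[of "A * L" s "\<lambda>s. \<bar>Y s\<bar>", OF _ s])
        show "0 \<le> A * L" using A \<open>0 \<le> L\<close> by simp
        fix s t :: real
        assume st: "0 < s" "s < t" "t \<le> T" "t \<le> 2 * s"
        have "\<bar>Z t - Z s\<bar> \<le> \<bar>K\<bar> * \<bar>t - s\<bar> powr \<kappa>"
          using holder_bound_abs[OF Z, of s t] st by simp
        also have "\<dots> \<le> \<bar>K\<bar> * s powr \<kappa>"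
          using st assms by (intro mult_left_mono powr_mono2) auto
        finally have Zst: "\<bar>Z t - Z s\<bar> \<le> \<bar>K\<bar> * s powr \<kappa>" .
        have "\<bar>Y' s * (Z t - Z s)\<bar> \<le> (A + c\<^sub>1 * A * s powr q) * (\<bar>K\<bar> * s powr \<kappa>)"
          unfolding abs_mult using Y'[of s] Zst st A c1 by (intro mult_mono) auto
        also have "\<dots> = A * \<bar>K\<bar> * s powr \<kappa> + c\<^sub>1 * A * \<bar>K\<bar> * s powr p"
          by (simp add: algebra_simps p_def q_def min_def flip: powr_add)
        also have "\<dots> \<le> A * \<bar>K\<bar> * (T powr (\<kappa> - p) * s powr p) + c\<^sub>1 * A * \<bar>K\<bar> * s powr p"
          using powr_le_lower_exponent[of s T p \<kappa>] st A
          by (intro add_right_mono mult_left_mono) (auto simp: p_def)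
        finally have 1: "\<bar>Y' s * (Z t - Z s)\<bar>
            \<le> A * \<bar>K\<bar> * (T powr (\<kappa> - p) * s powr p) + c\<^sub>1 * A * \<bar>K\<bar> * s powr p" .
        have "\<bar>Y t - Y s - Y' s * (Z t - Z s)\<bar> \<le> N * s powr \<eta>"
          using incr[OF st] .
        also have "\<dots> \<le> A * (T powr (\<eta> - p) * s powr p)"
          using powr_le_lower_exponent[of s T p \<eta>] st A \<open>0 \<le> N\<close>
          by (intro mult_mono) (auto simp: p_def)
        finally have 2: "\<bar>Y t - Y s - Y' s * (Z t - Z s)\<bar> \<le> A * (T powr (\<eta> - p) * s powr p)" .
        have "A * L * s powr p = A * \<bar>K\<bar> * (T powr (\<kappa> - p) * s powr p) + c\<^sub>1 * A * \<bar>K\<bar> * s powr p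
            + A * (T powr (\<eta> - p) * s powr p)"
          by (simp add: L_def algebra_simps)
        with 1 2 show "\<bar>Y s\<bar> \<le> \<bar>Y t\<bar> + A * L * s powr p"
          by linarith
      qed
      moreover have "min p 0 = min \<eta> 0"
        using \<open>0 < \<kappa>\<close> by (auto simp: p_def)
      ultimately show ?thesis
        using A by simp
    qed
    show "size_bound T \<kappa> \<eta> Y Y' (C * (\<bar>Y T\<bar> + \<bar>Y' T\<bar> + N))"
      unfolding size_bound_def A_def[symmetric]
    proof (intro ballI conjI)
      fix s assume "s \<in> {0<..T}"
      then have s: "0 < s" "s \<le> T" by auto
      \<comment> \<open>Since the exponents are not positive, the weight is at least \<open>1\<close> and absorbs constants.\<close>
      have weight: "A + d * A * s powr r \<le> (1 + d) * A * min s 1 powr r" if "r \<le> 0" "0 \<le> d" for r d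
      proof -
        have "1 \<le> min s 1 powr r" "s powr r \<le> min s 1 powr r"
          using s that powr_mono2'[of r "min s 1" 1] powr_mono2'[of r "min s 1" s] by auto
        then have "A * 1 + d * A * s powr r \<le> A * min s 1 powr r + d * A * min s 1 powr r"
          using that A by (intro add_mono mult_left_mono) auto
        then show ?thesis
          by (simp add: algebra_simps)
      qed
      have enlarge: "(1 + d) * A * x \<le> C * A * x" if "1 + d \<le> C" "0 \<le> x" for d x
        using that A by (intro mult_right_mono) auto
      have "\<bar>Y s\<bar> \<le> (1 + c\<^sub>2 * L) * A * min s 1 powr min \<eta> 0"
        using Y[OF s] weight[of "min \<eta> 0" "c\<^sub>2 * L"] c2 \<open>0 \<le> L\<close> by (simp add: mult.assoc mult.left_commute)
      also have "\<dots> \<le> C * A * min s 1 powr min \<eta> 0"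
        using c1 by (intro enlarge) (auto simp: C_def)
      finally show "\<bar>Y s\<bar> \<le> C * A * min s 1 powr min \<eta> 0" .
      have "\<bar>Y' s\<bar> \<le> (1 + c\<^sub>1) * A * min s 1 powr q"
        using Y'[OF s] weight[of q c\<^sub>1] c1 by (simp add: q_def)
      also have "\<dots> \<le> C * A * min s 1 powr q"
        using c2 \<open>0 \<le> L\<close> by (intro enlarge) (auto simp: C_def)
      finally show "\<bar>Y' s\<bar> \<le> C * A * min s 1 powr min (\<eta> - \<kappa>) 0"
        by (simp add: q_def)
    qed
  qed
qed

lemma increment_bound_near_if_all:
  fixes \<eta> :: real
  assumes "0 \<le> N" "\<eta> \<le> \<gamma> + \<kappa>"
    and N: "increment_bound (all_pairs T) (\<lambda>s. s powr (\<eta> - (\<gamma> + \<kappa>))) \<kappa> \<gamma> Z Y Y' N"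
  shows "increment_bound (near_pairs T) (\<lambda>s. min s 1 powr (\<eta> - (\<gamma> + \<kappa>))) \<kappa> \<gamma> Z Y Y' N"
  unfolding increment_bound_def
proof (safe)
  fix s t :: real
  assume st: "0 < s" "s < t" "t \<le> T" "\<bar>t - s\<bar> \<le> s"
  have "s powr (\<eta> - (\<gamma> + \<kappa>)) \<le> min s 1 powr (\<eta> - (\<gamma> + \<kappa>))"
    using st assms by (intro powr_mono2') auto
  then have weight: "N * (s powr (\<eta> - (\<gamma> + \<kappa>)) * x) \<le> N * (min s 1 powr (\<eta> - (\<gamma> + \<kappa>)) * x)"
    if "0 \<le> x" for x
    using that \<open>0 \<le> N\<close> by (intro mult_left_mono mult_right_mono) auto
  have "\<bar>Y' t - Y' s\<bar> \<le> N * (s powr (\<eta> - (\<gamma> + \<kappa>)) * \<bar>t - s\<bar> powr \<gamma>)"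
    "\<bar>Y t - Y s - Y' s * (Z t - Z s)\<bar> \<le> N * (s powr (\<eta> - (\<gamma> + \<kappa>)) * \<bar>t - s\<bar> powr (\<gamma> + \<kappa>))"
    using N st by (auto simp: increment_bound_def)
  then show "\<bar>Y' t - Y' s\<bar> \<le> N * (min s 1 powr (\<eta> - (\<gamma> + \<kappa>)) * \<bar>t - s\<bar> powr \<gamma>)"
    "\<bar>Y t - Y s - Y' s * (Z t - Z s)\<bar> \<le> N * (min s 1 powr (\<eta> - (\<gamma> + \<kappa>)) * \<bar>t - s\<bar> powr (\<gamma> + \<kappa>))"
    by (meson order_trans weight powr_ge_zero)+
qed

text \<open>
  The increments of \<open>Y'\<close> over distant pairs come first, because they enter the defect of additivity
  \<open>R s t - R s u - R u t = (Y' u - Y' s) * (Z t - Z u)\<close> of the remainder. With \<open>u = t / 2\<close> this defect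
  is at most a multiple of \<open>s powr e * t powr (\<gamma> + \<kappa>)\<close>, just as the remainder over the near pair from
  \<open>u\<close> to \<open>t\<close>. Only the constant depends on the Hoelder constant \<open>K\<close> of \<open>Z\<close>.
\<close>

lemma increment_bound_all_if_near:
  fixes T \<kappa> \<gamma> \<eta> K :: real
  assumes "0 < \<kappa>" "0 < \<gamma>" "\<eta> \<le> \<gamma> + \<kappa>"
  obtains C where "0 < C" and
    "\<And>Z Y Y' N. \<lbrakk>0 \<le> N; holder_bound T \<kappa> K Z;
        increment_bound (near_pairs T) (\<lambda>s. min s 1 powr (\<eta> - (\<gamma> + \<kappa>))) \<kappa> \<gamma> Z Y Y' N\<rbrakk>
      \<Longrightarrow> increment_bound (all_pairs T) (\<lambda>s. s powr (\<eta> - (\<gamma> + \<kappa>))) \<kappa> \<gamma> Z Y Y' (C * N)"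
proof -
  define e where "e = \<eta> - (\<gamma> + \<kappa>)"
  have e: "e \<le> 0"
    using assms by (simp add: e_def)
  define M where "M = max 1 T powr (- e)"
  have M: "0 < M" using assms by (simp add: M_def)
  have weight: "min s 1 powr e \<le> M * s powr e" if "0 < s" "s \<le> T" for s
  proof -
    have "s \<le> max 1 T * min s 1"
      using that mult_right_mono[of 1 "max 1 T" s] by (auto simp: min_def)
    then have "min s 1 powr e \<le> (s / max 1 T) powr e"
      using that e by (intro powr_mono2') (auto simp: field_simps)
    also have "\<dots> = M * s powr e"
      using that by (simp add: M_def powr_divide powr_minus field_simps)
    finally show ?thesis .
  qed
  define c where "c a = 2 powr a / (2 powr a - 1 :: real)" for a :: real
  have c: "0 < c a" if "0 < a" for a
    using that by (simp add: c_def)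
  define C where
    "C = M * (1 + c \<gamma> * 2 powr \<gamma> + c (\<gamma> + \<kappa>) * (1 + c \<gamma> * \<bar>K\<bar>) * 2 powr (\<gamma> + \<kappa>))"
  show thesis
  proof (rule that)
    show "0 < C"
      using M c[of \<gamma>] c[of "\<gamma> + \<kappa>"] assms unfolding C_def
      by (intro mult_pos_pos add_pos_nonneg mult_nonneg_nonneg) auto
    fix Z Y Y' :: "real \<Rightarrow> real" and N :: real
    assume "0 \<le> N" and Z: "holder_bound T \<kappa> K Z"
      and N: "increment_bound (near_pairs T) (\<lambda>s. min s 1 powr (\<eta> - (\<gamma> + \<kappa>))) \<kappa> \<gamma> Z Y Y' N"
    define R where "R s t = Y t - Y s - Y' s * (Z t - Z s)" for s t
    define B where "B = M * N"
    have B: "0 \<le> B" using M \<open>0 \<le> N\<close> by (simp add: B_def)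
    have near': "\<bar>Y' t - Y' s\<bar> \<le> B * s powr e * (t - s) powr \<gamma>"
      and near: "\<bar>R s t\<bar> \<le> B * s powr e * (t - s) powr (\<gamma> + \<kappa>)"
      if "0 < s" "s < t" "t \<le> T" "t \<le> 2 * s" for s t
    proof -
      have w: "N * (min s 1 powr e * x) \<le> B * s powr e * x" if "0 \<le> x" for x
        using mult_left_mono[OF mult_right_mono[OF weight[of s] that] \<open>0 \<le> N\<close>]
          \<open>0 < s\<close> \<open>s < t\<close> \<open>t \<le> T\<close> by (simp add: B_def mult_ac)
      have "\<bar>Y' t - Y' s\<bar> \<le> N * (min s 1 powr e * (t - s) powr \<gamma>)"
        "\<bar>R s t\<bar> \<le> N * (min s 1 powr e * (t - s) powr (\<gamma> + \<kappa>))"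
        using N that by (auto simp: increment_bound_def R_def e_def)
      then show "\<bar>Y' t - Y' s\<bar> \<le> B * s powr e * (t - s) powr \<gamma>"
        "\<bar>R s t\<bar> \<le> B * s powr e * (t - s) powr (\<gamma> + \<kappa>)"
        by (meson order_trans w powr_ge_zero)+
    qed
    \<comment> \<open>For \<open>t > 2 * s\<close> the midpoint \<open>t / 2\<close> lies beyond \<open>s\<close>, so the weight there is at most the one at \<open>s\<close>.\<close>
    have far': "\<bar>Y' t - Y' s\<bar> \<le> c \<gamma> * (B * s powr e) * t powr \<gamma>"
      if "0 < s" "s < t" "t \<le> T" for s t
      unfolding c_def
    proof (rule forward_telescope[of \<gamma> _ s t T "\<lambda>t. \<bar>Y' t - Y' s\<bar>"])
      fix t assume t: "s < t" "t \<le> T" "t \<le> 2 * s"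
      have "\<bar>Y' t - Y' s\<bar> \<le> B * s powr e * (t - s) powr \<gamma>"
        using near'[of s t] t that by simp
      also have "\<dots> \<le> B * s powr e * t powr \<gamma>"
        using t that B assms by (intro mult_left_mono powr_mono2) auto
      finally show "\<bar>Y' t - Y' s\<bar> \<le> B * s powr e * t powr \<gamma>" .
    next
      fix t assume t: "2 * s < t" "t \<le> T"
      have "\<bar>Y' t - Y' (t / 2)\<bar> \<le> B * (t / 2) powr e * (t - t / 2) powr \<gamma>"
        using near'[of "t / 2" t] t that by simp
      also have "\<dots> \<le> B * s powr e * t powr \<gamma>"
        using t that B e assms by (intro mult_mono mult_left_mono powr_mono2 powr_mono2') auto
      finally show "\<bar>Y' t - Y' s\<bar> \<le> \<bar>Y' (t / 2) - Y' s\<bar> + B * s powr e * t powr \<gamma>"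
        by linarith
    qed (use that assms B in auto)
    have far: "\<bar>R s t\<bar> \<le> c (\<gamma> + \<kappa>) * (B * s powr e * (1 + c \<gamma> * \<bar>K\<bar>)) * t powr (\<gamma> + \<kappa>)"
      if "0 < s" "s < t" "t \<le> T" for s t
      unfolding c_def[of "\<gamma> + \<kappa>"]
    proof (rule forward_telescope[of "\<gamma> + \<kappa>" _ s t T "\<lambda>t. \<bar>R s t\<bar>"])
      have c': "0 \<le> c \<gamma> * \<bar>K\<bar>"
        using c[of \<gamma>] assms by simp
      show "0 \<le> B * s powr e * (1 + c \<gamma> * \<bar>K\<bar>)"
        using B c' by simp
      fix t assume t: "s < t" "t \<le> T" "t \<le> 2 * s"
      have "\<bar>R s t\<bar> \<le> B * s powr e * 1 * (t - s) powr (\<gamma> + \<kappa>)"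
        using near[of s t] t that by simp
      also have "\<dots> \<le> B * s powr e * (1 + c \<gamma> * \<bar>K\<bar>) * t powr (\<gamma> + \<kappa>)"
        using t that B c' assms by (intro mult_mono mult_left_mono powr_mono2) auto
      finally show "\<bar>R s t\<bar> \<le> B * s powr e * (1 + c \<gamma> * \<bar>K\<bar>) * t powr (\<gamma> + \<kappa>)" .
    next
      fix t assume t: "2 * s < t" "t \<le> T"
      have "\<bar>R (t / 2) t\<bar> \<le> B * (t / 2) powr e * (t - t / 2) powr (\<gamma> + \<kappa>)"
        using near[of "t / 2" t] t that by simp
      also have "\<dots> \<le> B * s powr e * t powr (\<gamma> + \<kappa>)"
        using t that B e assms by (intro mult_mono mult_left_mono powr_mono2 powr_mono2') auto
      finally have 1: "\<bar>R (t / 2) t\<bar> \<le> B * s powr e * t powr (\<gamma> + \<kappa>)" .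
      have "\<bar>Y' (t / 2) - Y' s\<bar> \<le> c \<gamma> * (B * s powr e) * (t / 2) powr \<gamma>"
        using far'[of s "t / 2"] t that by simp
      also have "\<dots> \<le> c \<gamma> * (B * s powr e) * t powr \<gamma>"
        using t that B c[of \<gamma>] assms by (intro mult_left_mono powr_mono2) auto
      finally have a: "\<bar>Y' (t / 2) - Y' s\<bar> \<le> c \<gamma> * (B * s powr e) * t powr \<gamma>" .
      have "\<bar>Z t - Z (t / 2)\<bar> \<le> \<bar>K\<bar> * \<bar>t - t / 2\<bar> powr \<kappa>"
        using holder_bound_abs[OF Z, of "t / 2" t] t that by simp
      also have "\<dots> \<le> \<bar>K\<bar> * t powr \<kappa>"
        using t that assms by (intro mult_left_mono powr_mono2) auto
      finally have b: "\<bar>Z t - Z (t / 2)\<bar> \<le> \<bar>K\<bar> * t powr \<kappa>" .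
      have 2: "\<bar>(Y' (t / 2) - Y' s) * (Z t - Z (t / 2))\<bar>
          \<le> (c \<gamma> * (B * s powr e) * t powr \<gamma>) * (\<bar>K\<bar> * t powr \<kappa>)"
        unfolding abs_mult using a b B c[of \<gamma>] assms by (intro mult_mono) auto
      have 3: "B * s powr e * (1 + c \<gamma> * \<bar>K\<bar>) * t powr (\<gamma> + \<kappa>) =
          B * s powr e * t powr (\<gamma> + \<kappa>) + (c \<gamma> * (B * s powr e) * t powr \<gamma>) * (\<bar>K\<bar> * t powr \<kappa>)"
        by (simp add: powr_add algebra_simps)
      have "R s t = R s (t / 2) + R (t / 2) t + (Y' (t / 2) - Y' s) * (Z t - Z (t / 2))"
        by (simp add: R_def algebra_simps)
      with 1 2 3 show "\<bar>R s t\<bar> \<le> \<bar>R s (t / 2)\<bar> + B * s powr e * (1 + c \<gamma> * \<bar>K\<bar>) * t powr (\<gamma> + \<kappa>)"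
        by linarith
    qed (use that assms in auto)
    \<comment> \<open>Telescoping yields powers of \<open>t\<close>, which may be replaced by powers of \<open>t - s\<close> only for \<open>t > 2 * s\<close>.\<close>
    have near_or_far: "x \<le> C * N * (s powr e * (t - s) powr a)"
      if "0 < s" "s < t" "t \<le> T" "0 \<le> a" "0 \<le> d" "M * (1 + d * 2 powr a) \<le> C"
        and "t \<le> 2 * s \<Longrightarrow> x \<le> B * s powr e * (t - s) powr a"
        and "x \<le> d * (B * s powr e) * t powr a" for s t a d x
    proof -
      have "x \<le> (1 + d * 2 powr a) * (B * s powr e * (t - s) powr a)"
      proof (cases "t \<le> 2 * s")
        case True
        have "1 * (B * s powr e * (t - s) powr a) \<le> (1 + d * 2 powr a) * (B * s powr e * (t - s) powr a)"
          using B that by (intro mult_right_mono) auto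
        with that True show ?thesis by simp
      next
        case False
        have "t powr a \<le> (2 * (t - s)) powr a"
          using that False by (intro powr_mono2) auto
        also have "\<dots> = 2 powr a * (t - s) powr a"
          using that by (intro powr_mult)
        finally have "d * (B * s powr e) * t powr a \<le> d * (B * s powr e) * (2 powr a * (t - s) powr a)"
          using that B by (intro mult_left_mono) auto
        also have "\<dots> = (d * 2 powr a) * (B * s powr e * (t - s) powr a)"
          by simp
        also have "\<dots> \<le> (1 + d * 2 powr a) * (B * s powr e * (t - s) powr a)"
          using B that by (intro mult_right_mono) auto
        finally show ?thesis
          using that(8) by linarith
      qed
      also have "\<dots> = M * (1 + d * 2 powr a) * (N * (s powr e * (t - s) powr a))"
        by (simp add: B_def)
      also have "\<dots> \<le> C * (N * (s powr e * (t - s) powr a))"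
        using that \<open>0 \<le> N\<close> by (intro mult_right_mono) auto
      finally show ?thesis
        by (simp add: mult.assoc)
    qed
    have "0 \<le> c (\<gamma> + \<kappa>) * (1 + c \<gamma> * \<bar>K\<bar>)"
      using c[of \<gamma>] c[of "\<gamma> + \<kappa>"] assms by (intro mult_nonneg_nonneg) auto
    moreover have "0 \<le> c \<gamma>"
      using c[of \<gamma>] assms by simp
    ultimately have const: "M * (1 + c \<gamma> * 2 powr \<gamma>) \<le> C"
      "M * (1 + c (\<gamma> + \<kappa>) * (1 + c \<gamma> * \<bar>K\<bar>) * 2 powr (\<gamma> + \<kappa>)) \<le> C"
      using M unfolding C_def by (auto intro!: mult_left_mono)
    show "increment_bound (all_pairs T) (\<lambda>s. s powr (\<eta> - (\<gamma> + \<kappa>))) \<kappa> \<gamma> Z Y Y' (C * N)"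
      unfolding increment_bound_def e_def[symmetric]
    proof (safe)
      fix s t :: real
      assume st: "0 < s" "s < t" "t \<le> T"
      show "\<bar>Y' t - Y' s\<bar> \<le> C * N * (s powr e * \<bar>t - s\<bar> powr \<gamma>)"
        using near_or_far[OF st _ \<open>0 \<le> c \<gamma>\<close> const(1) near'[OF st] far'[OF st]] st assms by simp
      have "\<bar>R s t\<bar> \<le> c (\<gamma> + \<kappa>) * (1 + c \<gamma> * \<bar>K\<bar>) * (B * s powr e) * t powr (\<gamma> + \<kappa>)"
        using far[OF st] by (simp add: mult_ac)
      then show "\<bar>Y t - Y s - Y' s * (Z t - Z s)\<bar> \<le> C * N * (s powr e * \<bar>t - s\<bar> powr (\<gamma> + \<kappa>))"
        using near_or_far[OF st _ \<open>0 \<le> c (\<gamma> + \<kappa>) * (1 + c \<gamma> * \<bar>K\<bar>)\<close> const(2) near[OF st]] st assms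
        by (simp add: R_def)
    qed
  qed
qed

section \<open>Comparison of the two norms\<close>

lemma increment_bound_mono:
  assumes "increment_bound I w \<kappa> \<gamma> Z Y Y' M" "M \<le> N" "\<And>s. 0 \<le> w s"
  shows "increment_bound I w \<kappa> \<gamma> Z Y Y' N"
proof -
  have "M * (w s * x) \<le> N * (w s * x)" if "0 \<le> x" for s x
    using that assms by (intro mult_right_mono mult_nonneg_nonneg)
  then have le: "M * (w s * \<bar>t - s\<bar> powr a) \<le> N * (w s * \<bar>t - s\<bar> powr a)" for s t a
    by simp
  show ?thesis
    using assms(1) by (fastforce simp: increment_bound_def intro!: order_trans[OF _ le])
qed

lemma size_bound_mono:
  assumes "size_bound T \<kappa> \<eta> Y Y' M" "M \<le> N"
  shows "size_bound T \<kappa> \<eta> Y Y' N"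
proof -
  have le: "M * min s 1 powr a \<le> N * min s 1 powr a" for s a :: real
    using assms by (intro mult_right_mono) auto
  show ?thesis
    using assms(1) by (auto simp: size_bound_def intro!: order_trans[OF _ le])
qed

text \<open>
  The values at \<open>T\<close> are the starting values of the telescoping sums; the controlled norm alone
  vanishes on constant pairs \<open>(Y, 0)\<close> and cannot bound the size of the components.
\<close>

lemma modelled_norm_le_controlled_norm:
  fixes T \<alpha> \<beta> \<gamma> \<eta> \<kappa> K :: real
  assumes "0 < T" "0 < \<kappa>" "0 < \<gamma>" "\<eta> \<le> \<gamma> + \<kappa>" "\<eta> \<noteq> 0" "\<eta> \<noteq> \<kappa>" and deg: "deg \<alpha> \<beta> \<sigma> = \<kappa>"
  shows "\<exists>C>0. \<forall>XXX Z F. translates XXX \<sigma> Z \<longrightarrow> supported_on T \<sigma> F \<longrightarrow> holder_bound T \<kappa> K Z \<longrightarrow>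
      modelled_norm T \<alpha> \<beta> XXX (\<gamma> + \<kappa>) \<eta> F \<le> ennreal C *
        (ennreal \<bar>F T $ Sym_One\<bar> + ennreal \<bar>F T $ \<sigma>\<bar> +
         controlled_norm T \<kappa> \<gamma> \<eta> Z (\<lambda>s. F s $ Sym_One, \<lambda>s. F s $ \<sigma>))"
proof -
  obtain C where "0 < C" and C:
    "\<And>Z Y Y' N. \<lbrakk>0 \<le> N; holder_bound T \<kappa> K Z;
        increment_bound (all_pairs T) (\<lambda>s. s powr (\<eta> - (\<gamma> + \<kappa>))) \<kappa> \<gamma> Z Y Y' N\<rbrakk>
      \<Longrightarrow> size_bound T \<kappa> \<eta> Y Y' (C * (\<bar>Y T\<bar> + \<bar>Y' T\<bar> + N))"
    using size_bound_if_controlled[OF \<open>0 < T\<close> \<open>0 < \<kappa>\<close> \<open>0 < \<gamma>\<close> \<open>\<eta> \<noteq> 0\<close> \<open>\<eta> \<noteq> \<kappa>\<close>, where K = K]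
    by blast
  define D where "D = max 1 C"
  have "0 < 2 * D"
    by (simp add: D_def)
  show ?thesis
  proof (intro exI[of _ "2 * D"] conjI[OF \<open>0 < 2 * D\<close>] allI impI)
    fix XXX Z F
    assume XXX: "translates XXX \<sigma> Z" and F: "supported_on T \<sigma> F" and Z: "holder_bound T \<kappa> K Z"
    let ?Y = "\<lambda>s. F s $ Sym_One" and ?Y' = "\<lambda>s. F s $ \<sigma>"
    let ?c = "controlled_norm T \<kappa> \<gamma> \<eta> Z (?Y, ?Y')"
    show "modelled_norm T \<alpha> \<beta> XXX (\<gamma> + \<kappa>) \<eta> F \<le>
      ennreal (2 * D) * (ennreal \<bar>?Y T\<bar> + ennreal \<bar>?Y' T\<bar> + ?c)"
    proof (cases "?c = top")
      case True
      then show ?thesis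
        using \<open>0 < 2 * D\<close> by (simp add: ennreal_mult_top)
    next
      case False
      then obtain N where N: "0 \<le> N" "?c = ennreal N"
        by (cases ?c) auto
      then have incr: "increment_bound (all_pairs T) (\<lambda>s. s powr (\<eta> - (\<gamma> + \<kappa>))) \<kappa> \<gamma> Z ?Y ?Y' N"
        by (intro increment_bound_if_controlled_norm) auto
      define A where "A = \<bar>?Y T\<bar> + \<bar>?Y' T\<bar> + N"
      have "0 \<le> A" "N \<le> A"
        using N by (auto simp: A_def)
      have "C * A \<le> D * A"
        using \<open>0 \<le> A\<close> by (intro mult_right_mono) (auto simp: D_def)
      have "N \<le> D * A"
        using \<open>0 \<le> A\<close> \<open>N \<le> A\<close> mult_right_mono[of 1 D A] by (simp add: D_def)
      have "modelled_norm T \<alpha> \<beta> XXX (\<gamma> + \<kappa>) \<eta> F \<le> ennreal (2 * (D * A))"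
      proof (rule modelled_norm_le[OF XXX F deg])
        show "0 \<le> D * A"
          using N \<open>N \<le> D * A\<close> by linarith
        show "size_bound T \<kappa> \<eta> ?Y ?Y' (D * A)"
          using size_bound_mono[OF C[OF \<open>0 \<le> N\<close> Z incr]] \<open>C * A \<le> D * A\<close> by (simp add: A_def)
        show "increment_bound (near_pairs T) (\<lambda>s. min s 1 powr (\<eta> - (\<gamma> + \<kappa>))) \<kappa> \<gamma> Z ?Y ?Y' (D * A)"
          using increment_bound_near_if_all[OF \<open>0 \<le> N\<close> \<open>\<eta> \<le> \<gamma> + \<kappa>\<close> incr] \<open>N \<le> D * A\<close>
          by (rule increment_bound_mono) simp
      qed
      also have "\<dots> = ennreal (2 * D) * ennreal A"
        using \<open>0 \<le> A\<close> by (simp add: mult.assoc D_def flip: ennreal_mult)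
      also have "ennreal A = ennreal \<bar>?Y T\<bar> + ennreal \<bar>?Y' T\<bar> + ?c"
        using N by (simp add: A_def)
      finally show ?thesis .
    qed
  qed
qed

lemma controlled_norm_le_modelled_norm:
  fixes T \<alpha> \<beta> \<gamma> \<eta> \<kappa> K :: real
  assumes "0 < T" "0 < \<kappa>" "0 < \<gamma>" "\<eta> \<le> \<gamma> + \<kappa>" and deg: "deg \<alpha> \<beta> \<sigma> = \<kappa>"
  shows "\<exists>C>0. \<forall>XXX Z F. translates XXX \<sigma> Z \<longrightarrow> supported_on T \<sigma> F \<longrightarrow> holder_bound T \<kappa> K Z \<longrightarrow>
      ennreal \<bar>F T $ Sym_One\<bar> + ennreal \<bar>F T $ \<sigma>\<bar> +
        controlled_norm T \<kappa> \<gamma> \<eta> Z (\<lambda>s. F s $ Sym_One, \<lambda>s. F s $ \<sigma>)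
      \<le> ennreal C * modelled_norm T \<alpha> \<beta> XXX (\<gamma> + \<kappa>) \<eta> F"
proof -
  obtain C where "0 < C" and C:
    "\<And>Z Y Y' N. \<lbrakk>0 \<le> N; holder_bound T \<kappa> K Z;
        increment_bound (near_pairs T) (\<lambda>s. min s 1 powr (\<eta> - (\<gamma> + \<kappa>))) \<kappa> \<gamma> Z Y Y' N\<rbrakk>
      \<Longrightarrow> increment_bound (all_pairs T) (\<lambda>s. s powr (\<eta> - (\<gamma> + \<kappa>))) \<kappa> \<gamma> Z Y Y' (C * N)"
    using increment_bound_all_if_near[OF \<open>0 < \<kappa>\<close> \<open>0 < \<gamma>\<close> \<open>\<eta> \<le> \<gamma> + \<kappa>\<close>, where K = K]
    by blast
  define D where "D = min T 1 powr min \<eta> 0 + min T 1 powr min (\<eta> - \<kappa>) 0 + 2 * C"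
  have "0 < D"
    using \<open>0 < C\<close> by (simp add: D_def add_nonneg_pos)
  show ?thesis
  proof (intro exI[of _ D] conjI[OF \<open>0 < D\<close>] allI impI)
    fix XXX Z F
    assume XXX: "translates XXX \<sigma> Z" and F: "supported_on T \<sigma> F" and Z: "holder_bound T \<kappa> K Z"
    let ?Y = "\<lambda>s. F s $ Sym_One" and ?Y' = "\<lambda>s. F s $ \<sigma>"
    let ?m = "modelled_norm T \<alpha> \<beta> XXX (\<gamma> + \<kappa>) \<eta> F"
    show "ennreal \<bar>?Y T\<bar> + ennreal \<bar>?Y' T\<bar> + controlled_norm T \<kappa> \<gamma> \<eta> Z (?Y, ?Y') \<le> ennreal D * ?m"
    proof (cases "?m = top")
      case True
      then show ?thesis
        using \<open>0 < D\<close> by (simp add: ennreal_mult_top)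
    next
      case False
      then obtain N where N: "0 \<le> N" "?m = ennreal N"
        by (cases ?m) auto
      note bounds = bounds_if_modelled_norm[OF XXX F deg \<open>0 < \<kappa>\<close> \<open>0 < \<gamma>\<close> \<open>0 \<le> N\<close>
          eq_refl[OF N(2)]]
      have "controlled_norm T \<kappa> \<gamma> \<eta> Z (?Y, ?Y') \<le> ennreal (2 * (C * N))"
        using C[OF \<open>0 \<le> N\<close> Z bounds(2)] N \<open>0 < C\<close> by (intro controlled_norm_le) auto
      moreover have "\<bar>?Y T\<bar> \<le> N * min T 1 powr min \<eta> 0" "\<bar>?Y' T\<bar> \<le> N * min T 1 powr min (\<eta> - \<kappa>) 0"
        using bounds(1) \<open>0 < T\<close> by (auto simp: size_bound_def)
      ultimately have "ennreal \<bar>?Y T\<bar> + ennreal \<bar>?Y' T\<bar> + controlled_norm T \<kappa> \<gamma> \<eta> Z (?Y, ?Y')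
        \<le> ennreal (N * min T 1 powr min \<eta> 0) + ennreal (N * min T 1 powr min (\<eta> - \<kappa>) 0)
          + ennreal (2 * (C * N))"
        by (intro add_mono ennreal_leI)
      also have "\<dots> = ennreal (D * N)"
        using N \<open>0 < C\<close> by (simp add: D_def algebra_simps flip: ennreal_plus)
      also have "\<dots> = ennreal D * ?m"
        using N \<open>0 < D\<close> by (simp add: ennreal_mult)
      finally show ?thesis .
    qed
  qed
qed

lemma lift_sym_components:
  "lift_sym \<sigma> (Y, Y') s $ Sym_One = Y s" "lift_sym \<sigma> (Y, Y') s $ \<sigma> = Y' s"
  if "\<sigma> \<noteq> Sym_One"
  using that by (auto simp: lift_sym_def axis_def)

lemma supported_on_lift_sym: "supported_on T \<sigma> (lift_sym \<sigma> YY')"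
  by (simp add: supported_on_def lift_sym_def axis_def split: prod.split)

lemma lift_sym_in_modelled_space:
  fixes T \<alpha> \<beta> \<gamma> \<eta> \<kappa> :: real
  assumes "0 < T" "0 < \<kappa>" "0 < \<gamma>" "\<eta> \<le> \<gamma> + \<kappa>" "\<eta> \<noteq> 0" "\<eta> \<noteq> \<kappa>" and deg: "deg \<alpha> \<beta> \<sigma> = \<kappa>"
    and XXX: "translates XXX \<sigma> Z" and Z: "Z \<in> holder_space T \<kappa>"
    and Y: "(Y, Y') \<in> controlled_space T \<kappa> \<gamma> \<eta> Z"
  shows "lift_sym \<sigma> (Y, Y') \<in> modelled_space T \<alpha> \<beta> XXX (\<gamma> + \<kappa>) \<eta>"
proof -
  have "\<sigma> \<noteq> Sym_One"
    using XXX by (simp add: translates_def)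
  obtain K where K: "holder_bound T \<kappa> K Z"
    using Z by (auto simp: holder_space_def)
  obtain C where "0 < C" and C:
    "\<forall>XXX Z F. translates XXX \<sigma> Z \<longrightarrow> supported_on T \<sigma> F \<longrightarrow> holder_bound T \<kappa> K Z \<longrightarrow>
      modelled_norm T \<alpha> \<beta> XXX (\<gamma> + \<kappa>) \<eta> F \<le> ennreal C *
        (ennreal \<bar>F T $ Sym_One\<bar> + ennreal \<bar>F T $ \<sigma>\<bar> +
         controlled_norm T \<kappa> \<gamma> \<eta> Z (\<lambda>s. F s $ Sym_One, \<lambda>s. F s $ \<sigma>))"
    using modelled_norm_le_controlled_norm[OF assms(1-7), where K = K] by (elim exE conjE) (rule that)
  have "modelled_norm T \<alpha> \<beta> XXX (\<gamma> + \<kappa>) \<eta> (lift_sym \<sigma> (Y, Y')) \<le>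
      ennreal C * (ennreal \<bar>Y T\<bar> + ennreal \<bar>Y' T\<bar> + controlled_norm T \<kappa> \<gamma> \<eta> Z (Y, Y'))"
    using C[rule_format, OF XXX supported_on_lift_sym K, of "(Y, Y')"] by (simp add: lift_sym_components[OF \<open>\<sigma> \<noteq> Sym_One\<close>])
  also have "\<dots> < \<infinity>"
    using Y by (auto simp: controlled_space_def ennreal_mult_less_top)
  finally have "modelled_norm T \<alpha> \<beta> XXX (\<gamma> + \<kappa>) \<eta> (lift_sym \<sigma> (Y, Y')) < \<infinity>" .
  moreover have "lift_sym \<sigma> (Y, Y') s $ \<tau> = 0" if "s \<in> {0<..T}" "\<gamma> + \<kappa> \<le> deg \<alpha> \<beta> \<tau>" for s \<tau>
  proof -
    have "\<tau> \<noteq> Sym_One" "\<tau> \<noteq> \<sigma>"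
      using that assms by auto
    then show ?thesis
      using supported_on_lift_sym that(1) by (auto simp: supported_on_def)
  qed
  ultimately show ?thesis
    by (simp add: modelled_space_def)
qed

text \<open>
  The increments over distant pairs are recovered from those over near pairs. The bounds on the size
  of the components would not suffice: for \<open>\<eta> > \<kappa>\<close> they only say that \<open>Y'\<close> is bounded, whereas the
  admissible increment of \<open>Y'\<close> from \<open>s\<close> to \<open>3 * s\<close>, a multiple of \<open>s powr (\<eta> - \<kappa>)\<close>, tends to \<open>0\<close> with \<open>s\<close>.
\<close>

lemma components_in_controlled_space:
  fixes T \<alpha> \<beta> \<gamma> \<eta> \<kappa> :: real
  assumes "0 < T" "0 < \<kappa>" "0 < \<gamma>" "\<eta> \<le> \<gamma> + \<kappa>" and deg: "deg \<alpha> \<beta> \<sigma> = \<kappa>"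
    and XXX: "translates XXX \<sigma> Z" and Z: "Z \<in> holder_space T \<kappa>"
    and F: "F \<in> modelled_space T \<alpha> \<beta> XXX (\<gamma> + \<kappa>) \<eta>" "supported_on T \<sigma> F"
  shows "(\<lambda>s. F s $ Sym_One, \<lambda>s. F s $ \<sigma>) \<in> controlled_space T \<kappa> \<gamma> \<eta> Z"
proof -
  obtain K where K: "holder_bound T \<kappa> K Z"
    using Z by (auto simp: holder_space_def)
  obtain C where "0 < C" and C:
    "\<forall>XXX Z F. translates XXX \<sigma> Z \<longrightarrow> supported_on T \<sigma> F \<longrightarrow> holder_bound T \<kappa> K Z \<longrightarrow>
      ennreal \<bar>F T $ Sym_One\<bar> + ennreal \<bar>F T $ \<sigma>\<bar> +
        controlled_norm T \<kappa> \<gamma> \<eta> Z (\<lambda>s. F s $ Sym_One, \<lambda>s. F s $ \<sigma>)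
      \<le> ennreal C * modelled_norm T \<alpha> \<beta> XXX (\<gamma> + \<kappa>) \<eta> F"
    using controlled_norm_le_modelled_norm[OF assms(1-5), where K = K] by (elim exE conjE) (rule that)
  have "controlled_norm T \<kappa> \<gamma> \<eta> Z (\<lambda>s. F s $ Sym_One, \<lambda>s. F s $ \<sigma>) \<le>
      ennreal \<bar>F T $ Sym_One\<bar> + ennreal \<bar>F T $ \<sigma>\<bar> +
        controlled_norm T \<kappa> \<gamma> \<eta> Z (\<lambda>s. F s $ Sym_One, \<lambda>s. F s $ \<sigma>)"
    by (rule add_increasing) auto
  also have "\<dots> \<le> ennreal C * modelled_norm T \<alpha> \<beta> XXX (\<gamma> + \<kappa>) \<eta> F"
    by (rule C[rule_format, OF XXX F(2) K])
  also have "\<dots> < \<infinity>"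
    using F(1) by (auto simp: modelled_space_def ennreal_mult_less_top)
  finally show ?thesis
    by (simp add: controlled_space_def)
qed

text \<open>
  The constant is chosen before the rough path; it depends on the driving path only through its
  Hoelder constant \<open>K\<close>.
\<close>

lemma lift_sym_norm_equivalence:
  fixes T \<alpha> \<beta> \<gamma> \<eta> \<kappa> K :: real
  assumes "0 < T" "0 < \<kappa>" "0 < \<gamma>" "\<eta> \<le> \<gamma> + \<kappa>" and deg: "deg \<alpha> \<beta> \<sigma> = \<kappa>"
  shows "\<exists>C>0. \<forall>XXX Z Y Y'. translates XXX \<sigma> Z \<longrightarrow> holder_bound T \<kappa> K Z \<longrightarrow>
      (\<eta> \<noteq> 0 \<and> \<eta> \<noteq> \<kappa> \<longrightarrow>
        ennreal (1 / C) * modelled_norm T \<alpha> \<beta> XXX (\<gamma> + \<kappa>) \<eta> (lift_sym \<sigma> (Y, Y'))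
        \<le> ennreal \<bar>Y T\<bar> + ennreal \<bar>Y' T\<bar> + controlled_norm T \<kappa> \<gamma> \<eta> Z (Y, Y')) \<and>
      ennreal \<bar>Y T\<bar> + ennreal \<bar>Y' T\<bar> + controlled_norm T \<kappa> \<gamma> \<eta> Z (Y, Y')
      \<le> ennreal C * modelled_norm T \<alpha> \<beta> XXX (\<gamma> + \<kappa>) \<eta> (lift_sym \<sigma> (Y, Y'))"
proof -
  obtain C\<^sub>2 where "0 < C\<^sub>2" and C2:
    "\<forall>XXX Z F. translates XXX \<sigma> Z \<longrightarrow> supported_on T \<sigma> F \<longrightarrow> holder_bound T \<kappa> K Z \<longrightarrow>
      ennreal \<bar>F T $ Sym_One\<bar> + ennreal \<bar>F T $ \<sigma>\<bar> +
        controlled_norm T \<kappa> \<gamma> \<eta> Z (\<lambda>s. F s $ Sym_One, \<lambda>s. F s $ \<sigma>)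
      \<le> ennreal C\<^sub>2 * modelled_norm T \<alpha> \<beta> XXX (\<gamma> + \<kappa>) \<eta> F"
    using controlled_norm_le_modelled_norm[OF assms, where K = K] by (elim exE conjE) (rule that)
  obtain C\<^sub>1 where C1:
    "\<eta> \<noteq> 0 \<and> \<eta> \<noteq> \<kappa> \<longrightarrow> (\<forall>XXX Z F.
      translates XXX \<sigma> Z \<longrightarrow> supported_on T \<sigma> F \<longrightarrow> holder_bound T \<kappa> K Z \<longrightarrow>
      modelled_norm T \<alpha> \<beta> XXX (\<gamma> + \<kappa>) \<eta> F \<le> ennreal C\<^sub>1 *
        (ennreal \<bar>F T $ Sym_One\<bar> + ennreal \<bar>F T $ \<sigma>\<bar> +
         controlled_norm T \<kappa> \<gamma> \<eta> Z (\<lambda>s. F s $ Sym_One, \<lambda>s. F s $ \<sigma>)))"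
  proof (cases "\<eta> \<noteq> 0 \<and> \<eta> \<noteq> \<kappa>")
    case True
    then have "\<eta> \<noteq> 0" "\<eta> \<noteq> \<kappa>"
      by simp_all
    from modelled_norm_le_controlled_norm[OF assms(1-4) this deg, where K = K] show ?thesis
      by (elim exE conjE) (rule that, rule impI)
  next
    case False
    show ?thesis
      by (rule that[of 0], rule impI, rule notE[OF False])
  qed
  define C where "C = max C\<^sub>1 C\<^sub>2"
  have C: "0 < C" "C\<^sub>1 \<le> C" "C\<^sub>2 \<le> C"
    using \<open>0 < C\<^sub>2\<close> by (auto simp: C_def)
  show ?thesis
  proof (intro exI[of _ C] conjI[OF \<open>0 < C\<close>] allI impI conjI)
    fix XXX Z Y Y'
    assume XXX: "translates XXX \<sigma> Z" and Z: "holder_bound T \<kappa> K Z"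
    let ?m = "modelled_norm T \<alpha> \<beta> XXX (\<gamma> + \<kappa>) \<eta> (lift_sym \<sigma> (Y, Y'))"
    let ?c = "ennreal \<bar>Y T\<bar> + ennreal \<bar>Y' T\<bar> + controlled_norm T \<kappa> \<gamma> \<eta> Z (Y, Y')"
    have "\<sigma> \<noteq> Sym_One"
      using XXX by (simp add: translates_def)
    note [simp] = lift_sym_components[OF this]
    have "?c \<le> ennreal C\<^sub>2 * ?m"
      using C2[rule_format, OF XXX supported_on_lift_sym Z, of "(Y, Y')"] by simp
    also have "\<dots> \<le> ennreal C * ?m"
      using C by (intro mult_right_mono ennreal_leI) auto
    finally show "?c \<le> ennreal C * ?m" .
    assume "\<eta> \<noteq> 0 \<and> \<eta> \<noteq> \<kappa>"
    then have "?m \<le> ennreal C\<^sub>1 * ?c"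
      using C1[rule_format, OF _ XXX supported_on_lift_sym Z, of "(Y, Y')"] by simp
    also have "\<dots> \<le> ennreal C * ?c"
      using C by (intro mult_right_mono ennreal_leI) auto
    finally have "ennreal (1 / C) * ?m \<le> ennreal (1 / C) * (ennreal C * ?c)"
      by (rule mult_left_mono) simp
    also have "\<dots> = ennreal (1 / C) * ennreal C * ?c"
      by (simp only: mult.assoc)
    also have "ennreal (1 / C) * ennreal C = 1"
      using C by (simp flip: ennreal_mult)
    finally show "ennreal (1 / C) * ?m \<le> ?c"
      by simp
  qed
qed

theorem theorem5p2:
  fixes T \<alpha> \<beta> \<gamma> :: real
  assumes "T > 0"
    and "0 < \<alpha>" "\<alpha> < 1" and "0 < \<beta>" "\<beta> < 1" and "0 < \<gamma>" "\<gamma> < 1"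
    and "\<alpha> + 2 * \<beta> > 1" and "\<alpha> + \<beta> + \<gamma> > 1"
  shows
    "(\<forall>\<eta>\<le>\<gamma> + \<beta>. \<forall>X Xh XX. (X, Xh, XX) \<in> rough_path_space T \<alpha> \<beta> \<longrightarrow>
         (\<eta> \<noteq> 0 \<and> \<eta> \<noteq> \<beta> \<longrightarrow>
            (\<forall>Y Y'. (Y, Y') \<in> controlled_space T \<beta> \<gamma> \<eta> Xh \<longrightarrow>
               lift_sym Sym_Xh (Y, Y') \<in> modelled_space T \<alpha> \<beta> (X, Xh, XX) (\<gamma> + \<beta>) \<eta>)) \<and>
         (\<eta> \<notin> \<int> \<longrightarrow>
            (\<forall>F \<in> modelled_space T \<alpha> \<beta> (X, Xh, XX) (\<gamma> + \<beta>) \<eta>.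
               (\<forall>s\<in>{0<..T}. \<forall>\<tau>. \<tau> \<noteq> Sym_One \<and> \<tau> \<noteq> Sym_Xh \<longrightarrow> F s $ \<tau> = 0) \<longrightarrow>
               ((\<lambda>s. F s $ Sym_One), (\<lambda>s. F s $ Sym_Xh)) \<in> controlled_space T \<beta> \<gamma> \<eta> Xh)))
     \<and> (\<forall>\<eta>\<le>\<gamma> + \<beta>. \<forall>K. \<exists>C>0. \<forall>X Xh XX Y Y'.
         (X, Xh, XX) \<in> rough_path_space T \<alpha> \<beta> \<longrightarrow> holder_bound T \<beta> K Xh \<longrightarrow>
         (Y, Y') \<in> controlled_space T \<beta> \<gamma> \<eta> Xh \<longrightarrow>
           (\<eta> \<noteq> 0 \<and> \<eta> \<noteq> \<beta> \<longrightarrow>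
              ennreal (1 / C) * modelled_norm T \<alpha> \<beta> (X, Xh, XX) (\<gamma> + \<beta>) \<eta> (lift_sym Sym_Xh (Y, Y'))
              \<le> ennreal \<bar>Y T\<bar> + ennreal \<bar>Y' T\<bar> + controlled_norm T \<beta> \<gamma> \<eta> Xh (Y, Y')) \<and>
           ennreal \<bar>Y T\<bar> + ennreal \<bar>Y' T\<bar> + controlled_norm T \<beta> \<gamma> \<eta> Xh (Y, Y')
           \<le> ennreal C * modelled_norm T \<alpha> \<beta> (X, Xh, XX) (\<gamma> + \<beta>) \<eta> (lift_sym Sym_Xh (Y, Y')))
     \<and> (\<forall>\<eta>\<le>\<gamma> + \<alpha>. \<forall>X Xh XX. (X, Xh, XX) \<in> rough_path_space T \<alpha> \<beta> \<longrightarrow>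
         (\<eta> \<noteq> 0 \<and> \<eta> \<noteq> \<alpha> \<longrightarrow>
            (\<forall>Y Y'. (Y, Y') \<in> controlled_space T \<alpha> \<gamma> \<eta> X \<longrightarrow>
               lift_sym Sym_X (Y, Y') \<in> modelled_space T \<alpha> \<beta> (X, Xh, XX) (\<gamma> + \<alpha>) \<eta>)) \<and>
         (\<eta> \<notin> \<int> \<longrightarrow>
            (\<forall>F \<in> modelled_space T \<alpha> \<beta> (X, Xh, XX) (\<gamma> + \<alpha>) \<eta>.
               (\<forall>s\<in>{0<..T}. \<forall>\<tau>. \<tau> \<noteq> Sym_One \<and> \<tau> \<noteq> Sym_X \<longrightarrow> F s $ \<tau> = 0) \<longrightarrow>
               ((\<lambda>s. F s $ Sym_One), (\<lambda>s. F s $ Sym_X)) \<in> controlled_space T \<alpha> \<gamma> \<eta> X)))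
     \<and> (\<forall>\<eta>\<le>\<gamma> + \<alpha>. \<forall>K. \<exists>C>0. \<forall>X Xh XX Y Y'.
         (X, Xh, XX) \<in> rough_path_space T \<alpha> \<beta> \<longrightarrow> holder_bound T \<alpha> K X \<longrightarrow>
         (Y, Y') \<in> controlled_space T \<alpha> \<gamma> \<eta> X \<longrightarrow>
           (\<eta> \<noteq> 0 \<and> \<eta> \<noteq> \<alpha> \<longrightarrow>
              ennreal (1 / C) * modelled_norm T \<alpha> \<beta> (X, Xh, XX) (\<gamma> + \<alpha>) \<eta> (lift_sym Sym_X (Y, Y'))
              \<le> ennreal \<bar>Y T\<bar> + ennreal \<bar>Y' T\<bar> + controlled_norm T \<alpha> \<gamma> \<eta> X (Y, Y')) \<and>
           ennreal \<bar>Y T\<bar> + ennreal \<bar>Y' T\<bar> + controlled_norm T \<alpha> \<gamma> \<eta> X (Y, Y')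
           \<le> ennreal C * modelled_norm T \<alpha> \<beta> (X, Xh, XX) (\<gamma> + \<alpha>) \<eta> (lift_sym Sym_X (Y, Y')))"
proof (intro conjI allI impI ballI)
  fix \<eta> X Xh XX Y Y'
  assume "\<eta> \<le> \<gamma> + \<beta>" "(X, Xh, XX) \<in> rough_path_space T \<alpha> \<beta>" "\<eta> \<noteq> 0 \<and> \<eta> \<noteq> \<beta>"
    "(Y, Y') \<in> controlled_space T \<beta> \<gamma> \<eta> Xh"
  then show "lift_sym Sym_Xh (Y, Y') \<in> modelled_space T \<alpha> \<beta> (X, Xh, XX) (\<gamma> + \<beta>) \<eta>"
    using assms by (intro lift_sym_in_modelled_space[OF _ _ _ _ _ _ _ translates_Xh])
      (auto simp: rough_path_space_def)
next
  fix \<eta> X Xh XX F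
  assume "\<eta> \<le> \<gamma> + \<beta>" "(X, Xh, XX) \<in> rough_path_space T \<alpha> \<beta>"
    "F \<in> modelled_space T \<alpha> \<beta> (X, Xh, XX) (\<gamma> + \<beta>) \<eta>"
    "\<forall>s\<in>{0<..T}. \<forall>\<tau>. \<tau> \<noteq> Sym_One \<and> \<tau> \<noteq> Sym_Xh \<longrightarrow> F s $ \<tau> = 0"
  then show "(\<lambda>s. F s $ Sym_One, \<lambda>s. F s $ Sym_Xh) \<in> controlled_space T \<beta> \<gamma> \<eta> Xh"
    using assms by (intro components_in_controlled_space[OF _ _ _ _ _ translates_Xh])
      (auto simp: rough_path_space_def supported_on_def)
next
  fix \<eta> K
  assume \<eta>: "\<eta> \<le> \<gamma> + \<beta>"
  show "\<exists>C>0. \<forall>X Xh XX Y Y'.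
         (X, Xh, XX) \<in> rough_path_space T \<alpha> \<beta> \<longrightarrow> holder_bound T \<beta> K Xh \<longrightarrow>
         (Y, Y') \<in> controlled_space T \<beta> \<gamma> \<eta> Xh \<longrightarrow>
           (\<eta> \<noteq> 0 \<and> \<eta> \<noteq> \<beta> \<longrightarrow>
              ennreal (1 / C) * modelled_norm T \<alpha> \<beta> (X, Xh, XX) (\<gamma> + \<beta>) \<eta> (lift_sym Sym_Xh (Y, Y'))
              \<le> ennreal \<bar>Y T\<bar> + ennreal \<bar>Y' T\<bar> + controlled_norm T \<beta> \<gamma> \<eta> Xh (Y, Y')) \<and>
           ennreal \<bar>Y T\<bar> + ennreal \<bar>Y' T\<bar> + controlled_norm T \<beta> \<gamma> \<eta> Xh (Y, Y')
           \<le> ennreal C * modelled_norm T \<alpha> \<beta> (X, Xh, XX) (\<gamma> + \<beta>) \<eta> (lift_sym Sym_Xh (Y, Y'))"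
    by (rule ex_forward[OF lift_sym_norm_equivalence[OF \<open>T > 0\<close> \<open>0 < \<beta>\<close> \<open>0 < \<gamma>\<close> \<eta>
            deg.simps(6), where K = K]])
      (blast intro: translates_Xh)
next
  fix \<eta> X Xh XX Y Y'
  assume "\<eta> \<le> \<gamma> + \<alpha>" "(X, Xh, XX) \<in> rough_path_space T \<alpha> \<beta>" "\<eta> \<noteq> 0 \<and> \<eta> \<noteq> \<alpha>"
    "(Y, Y') \<in> controlled_space T \<alpha> \<gamma> \<eta> X"
  then show "lift_sym Sym_X (Y, Y') \<in> modelled_space T \<alpha> \<beta> (X, Xh, XX) (\<gamma> + \<alpha>) \<eta>"
    using assms by (intro lift_sym_in_modelled_space[OF _ _ _ _ _ _ _ translates_X])
      (auto simp: rough_path_space_def)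
next
  fix \<eta> X Xh XX F
  assume "\<eta> \<le> \<gamma> + \<alpha>" "(X, Xh, XX) \<in> rough_path_space T \<alpha> \<beta>"
    "F \<in> modelled_space T \<alpha> \<beta> (X, Xh, XX) (\<gamma> + \<alpha>) \<eta>"
    "\<forall>s\<in>{0<..T}. \<forall>\<tau>. \<tau> \<noteq> Sym_One \<and> \<tau> \<noteq> Sym_X \<longrightarrow> F s $ \<tau> = 0"
  then show "(\<lambda>s. F s $ Sym_One, \<lambda>s. F s $ Sym_X) \<in> controlled_space T \<alpha> \<gamma> \<eta> X"
    using assms by (intro components_in_controlled_space[OF _ _ _ _ _ translates_X])
      (auto simp: rough_path_space_def supported_on_def)
next
  fix \<eta> K
  assume \<eta>: "\<eta> \<le> \<gamma> + \<alpha>"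
  show "\<exists>C>0. \<forall>X Xh XX Y Y'.
         (X, Xh, XX) \<in> rough_path_space T \<alpha> \<beta> \<longrightarrow> holder_bound T \<alpha> K X \<longrightarrow>
         (Y, Y') \<in> controlled_space T \<alpha> \<gamma> \<eta> X \<longrightarrow>
           (\<eta> \<noteq> 0 \<and> \<eta> \<noteq> \<alpha> \<longrightarrow>
              ennreal (1 / C) * modelled_norm T \<alpha> \<beta> (X, Xh, XX) (\<gamma> + \<alpha>) \<eta> (lift_sym Sym_X (Y, Y'))
              \<le> ennreal \<bar>Y T\<bar> + ennreal \<bar>Y' T\<bar> + controlled_norm T \<alpha> \<gamma> \<eta> X (Y, Y')) \<and>
           ennreal \<bar>Y T\<bar> + ennreal \<bar>Y' T\<bar> + controlled_norm T \<alpha> \<gamma> \<eta> X (Y, Y')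
           \<le> ennreal C * modelled_norm T \<alpha> \<beta> (X, Xh, XX) (\<gamma> + \<alpha>) \<eta> (lift_sym Sym_X (Y, Y'))"
    by (rule ex_forward[OF lift_sym_norm_equivalence[OF \<open>T > 0\<close> \<open>0 < \<alpha>\<close> \<open>0 < \<gamma>\<close> \<eta>
            deg.simps(5), where K = K]])
      (blast intro: translates_X)
qed

end
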